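(* Let $A,B\in 2^\omega$. If $A\leq_{LR}B$, then $A\leq_{LK}B$.
   Context: Subsets of $\omega$ are identified with elements of $2^\omega$; $\mu$ is Lebesgue (fair-coin) measure on $2^\omega$. For an oracle $A$, a Martin-Löf test relative to $A$ is an $A$-computable (i.e. uniformly $\Sigma^A_1$) nested sequence of $\Sigma^A_1$ classes $U^A_0\supseteq U^A_1\supseteq\cdots$ in $2^\omega$ with $\mu(U^A_n)\leq 2^{-n}$ for all $n$. A set $R\in 2^\omega$ is $A$-random if $R\notin\bigcap_{n}U^A_n$ for every Martin-Löf test relative to $A$. $A\leq_{LR}B$ means: every $B$-random set is $A$-random. For an oracle $A$, $K^A(\tau)=\min\{|\sigma| : U^A(\sigma)=\tau\}$ denotes prefix-free Kolmogorov complexity relative to $A$ of the finite binary string $\tau$, where $U^A$ is a fixed universal prefix-free oracle machine ($K^A$ is well defined up to an additive constant). $A\leq_{LK}B$ means: there is a constant $c$ such that $K^B(\tau)\leq K^A(\tau)+c$ for all $\tau\in 2^{<\omega}$. *)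

theory Defs
  imports
    "HOL-Probability.Probability"
    "HOL-Library.Nat_Bijection"
    "HOL-Library.Sublist"
    "HOL-Library.Extended_Nat"
begin

text \<open>Elements of Cantor space, identified with subsets of \<open>\<omega>\<close> via characteristic functions.\<close>

type_synonym cantor = "nat \<Rightarrow> bool"

section \<open>Relative computability\<close>

text \<open>
  Kleene's partial recursive functions relative to a set \<open>A\<close>, presented as unary functions on
  \<open>nat\<close>, with several arguments packed by the Cantor pairing \<^const>\<open>prod_encode\<close>. The program is
  separated from the set it queries, so that one program acts uniformly on all of them.
\<close>

datatype prog =
    Zero
  | Succ
  | Fst
  | Snd
  | Query
  | Pair prog prog
  | Comp prog prog
  | Prec prog prog
  | Mu prog

definition mu_search :: "(nat \<Rightarrow> nat option) \<Rightarrow> nat option" where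
  "mu_search f =
    (if \<exists>n. f n = Some 0 \<and> (\<forall>m<n. f m \<noteq> None)
     then Some (LEAST n. f n = Some 0 \<and> (\<forall>m<n. f m \<noteq> None))
     else None)"

text \<open>
  \<open>None\<close> means divergence. \<open>Prec f g\<close> computes \<open>h\<close> with \<open>h (a, 0) = f a\<close> and
  \<open>h (a, Suc k) = g (a, (k, h (a, k)))\<close>; \<open>Mu f\<close> maps \<open>a\<close> to the least \<open>n\<close> with \<open>f (a, n) = 0\<close>,
  provided that \<open>f (a, m)\<close> is defined for all \<open>m < n\<close>.
\<close>

primrec run :: "cantor \<Rightarrow> prog \<Rightarrow> nat \<Rightarrow> nat option" where
  "run A Zero x = Some 0"
| "run A Succ x = Some (Suc x)"
| "run A Fst x = Some (fst (prod_decode x))"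
| "run A Snd x = Some (snd (prod_decode x))"
| "run A Query x = Some (if A x then 1 else 0)"
| "run A (Pair f g) x =
    Option.bind (run A f x) (\<lambda>y. map_option (\<lambda>z. prod_encode (y, z)) (run A g x))"
| "run A (Comp f g) x = Option.bind (run A g x) (run A f)"
| "run A (Prec f g) x =
    rec_nat (run A f (fst (prod_decode x)))
      (\<lambda>k r. Option.bind r
        (\<lambda>y. run A g (prod_encode (fst (prod_decode x), prod_encode (k, y)))))
      (snd (prod_decode x))"
| "run A (Mu f) x = mu_search (\<lambda>n. run A f (prod_encode (x, n)))"

definition str_code :: "bool list \<Rightarrow> nat" where
  "str_code \<sigma> = list_encode (map of_bool \<sigma>)"

section \<open>Randomness\<close>

definition coin_measure :: "cantor measure" where
  "coin_measure = Pi\<^sub>M UNIV (\<lambda>_. measure_pmf (bernoulli_pmf (1/2)))"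

definition initial_segment :: "bool list \<Rightarrow> cantor \<Rightarrow> bool" where
  "initial_segment \<sigma> X \<longleftrightarrow> map X [0..<length \<sigma>] = \<sigma>"

text \<open>
  \<open>U n\<close> is the open class generated by the \<open>n\<close>-th section of a single \<open>A\<close>-c.e. set of pairs
  \<open>(n, \<sigma>)\<close>; as usual, the \<open>A\<close>-c.e. sets are the domains of the partial \<open>A\<close>-computable functions.
\<close>

definition uniformly_Sigma1 :: "cantor \<Rightarrow> (nat \<Rightarrow> cantor set) \<Rightarrow> bool" where
  "uniformly_Sigma1 A U \<longleftrightarrow>
    (\<exists>e. \<forall>n. U n =
      {X. \<exists>\<sigma>. run A e (prod_encode (n, str_code \<sigma>)) \<noteq> None \<and> initial_segment \<sigma> X})"

definition martin_loef_test :: "cantor \<Rightarrow> (nat \<Rightarrow> cantor set) \<Rightarrow> bool" where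
  "martin_loef_test A U \<longleftrightarrow>
    uniformly_Sigma1 A U \<and> (\<forall>n. U (Suc n) \<subseteq> U n) \<and>
    (\<forall>n. measure coin_measure (U n) \<le> (1/2) ^ n)"

definition martin_loef_random :: "cantor \<Rightarrow> cantor \<Rightarrow> bool" where
  "martin_loef_random A R \<longleftrightarrow> (\<forall>U. martin_loef_test A U \<longrightarrow> R \<notin> (\<Inter>n. U n))"

definition leq_LR :: "cantor \<Rightarrow> cantor \<Rightarrow> bool" where
  "leq_LR A B \<longleftrightarrow> (\<forall>R. martin_loef_random B R \<longrightarrow> martin_loef_random A R)"

section \<open>Prefix-free Kolmogorov complexity\<close>

type_synonym machine = "cantor \<Rightarrow> bool list \<Rightarrow> bool list option"

definition computable_machine :: "machine \<Rightarrow> bool" where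
  "computable_machine M \<longleftrightarrow>
    (\<exists>e. \<forall>A \<sigma>. run A e (str_code \<sigma>) = map_option str_code (M A \<sigma>))"

definition prefix_free :: "bool list set \<Rightarrow> bool" where
  "prefix_free S \<longleftrightarrow> (\<forall>\<sigma>\<in>S. \<forall>\<tau>\<in>S. prefix \<sigma> \<tau> \<longrightarrow> \<sigma> = \<tau>)"

definition prefix_free_machine :: "machine \<Rightarrow> bool" where
  "prefix_free_machine M \<longleftrightarrow> computable_machine M \<and> (\<forall>A. prefix_free (dom (M A)))"

text \<open>
  The coding string \<open>\<rho>\<close> depends on the simulated machine \<open>M\<close> only, not on the set \<open>A\<close>.
\<close>

definition universal_machine :: "machine \<Rightarrow> bool" where
  "universal_machine U \<longleftrightarrow>
    prefix_free_machine U \<and>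
    (\<forall>M. prefix_free_machine M \<longrightarrow> (\<exists>\<rho>. \<forall>A \<sigma>. U A (\<rho> @ \<sigma>) = M A \<sigma>))"

text \<open>
  The infimum is a minimum for universal \<open>U\<close>, as every string then is an output of \<open>U A\<close>. For an
  arbitrary machine the value is \<open>\<infinity>\<close> on strings that are not outputs.
\<close>

definition K :: "machine \<Rightarrow> cantor \<Rightarrow> bool list \<Rightarrow> enat" where
  "K U A \<tau> = (INF \<sigma>\<in>{\<sigma>. U A \<sigma> = Some \<tau>}. enat (length \<sigma>))"

definition leq_LK :: "machine \<Rightarrow> cantor \<Rightarrow> cantor \<Rightarrow> bool" where
  "leq_LK U A B \<longleftrightarrow> (\<exists>c::nat. \<forall>\<tau>. K U B \<tau> \<le> K U A \<tau> + enat c)"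

end

theory Submission imports Defs begin

text \<open>
  A request \<open>i\<close> asks for a code of length \<open>n\<close> of a string \<open>\<tau>\<close>; the requests of \<open>U A\<close> are those with
  \<open>U A \<pi> = Some \<tau>\<close> for some \<open>\<pi>\<close> of length \<open>n\<close>. Give every request, for each \<open>k\<close>, its own block of
  \<open>n + k + 1\<close> coordinates, so that the events ``\<open>X\<close> vanishes on the block of \<open>i\<close>'' are independent
  with probabilities \<open>2 ^ -(n + k + 1)\<close>. By Kraft's inequality, the classes of those \<open>X\<close> that vanish
  on the block of some request of \<open>U A\<close> for some \<open>k > m\<close> form a Martin-Loef test relative to \<open>A\<close>.

  If no effectively open class relative to \<open>B\<close> of measure below \<open>1\<close> covered, up to a null set, all
  events of the requests of \<open>U A\<close> for a fixed \<open>k\<close>, then forcing with such classes would build a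
  \<open>B\<close>-random set in all levels of this test, contradicting \<open>A \<le>\<^sub>L\<^sub>R B\<close>. So let \<open>S\<close> be such a covering
  class. The set \<open>W\<close> of the requests whose event is nearly covered by \<open>S\<close> is c.e. in \<open>B\<close> and contains
  the requests of \<open>U A\<close>. The events of \<open>W\<close> still leave a set of positive measure uncovered, so by
  independence (as in the second Borel-Cantelli lemma) the weights \<open>2 ^ -n\<close> over \<open>W\<close> have a finite
  sum, and a prefix-free machine can serve all requests in \<open>W\<close> up to an additive constant.
\<close>

section \<open>Total computable functionals\<close>

abbreviation pfst :: "nat \<Rightarrow> nat" where "pfst n \<equiv> fst (prod_decode n)"
abbreviation psnd :: "nat \<Rightarrow> nat" where "psnd n \<equiv> snd (prod_decode n)"

text \<open>One program must serve all oracles at once, as \<open>computable_machine\<close>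
  demands. Totality lets functionals be composed without side conditions on convergence.\<close>

definition computable :: "(cantor \<Rightarrow> nat \<Rightarrow> nat) \<Rightarrow> bool" where
  "computable f \<longleftrightarrow> (\<exists>e. \<forall>A x. run A e x = Some (f A x))"

definition decidable :: "(cantor \<Rightarrow> nat \<Rightarrow> bool) \<Rightarrow> bool" where
  "decidable P \<longleftrightarrow> computable (\<lambda>A x. of_bool (P A x))"

named_theorems comp_intros

lemma computableI: "(\<And>A x. run A e x = Some (f A x)) \<Longrightarrow> computable f"
  unfolding computable_def by blast

lemma computable_comp:
  assumes "computable h" "computable f"
  shows "computable (\<lambda>A x. h A (f A x))"
proof -
  from assms obtain a b where "\<And>A x. run A a x = Some (h A x)" "\<And>A x. run A b x = Some (f A x)"
    unfolding computable_def by blast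
  then show ?thesis by (intro computableI[of "Comp a b"]) simp
qed

text \<open>The programs have no identity; decoding a number and pairing its two components again
  gives one. The idiom \<open>Pair Fst Snd\<close> recurs below.\<close>

lemma computable_id [comp_intros]: "computable (\<lambda>A x. x)"
  by (rule computableI[of "Pair Fst Snd"]) simp

lemma computable_Suc [comp_intros]:
  assumes "computable f" shows "computable (\<lambda>A x. Suc (f A x))"
  by (rule computable_comp[OF _ assms]) (rule computableI[of Succ], simp)

lemma computable_zero [comp_intros]: "computable (\<lambda>A x. 0)"
  by (rule computableI[of Zero]) simp

lemma computable_const [comp_intros]: "computable (\<lambda>A x. c)"
  by (induction c) (auto intro: comp_intros)

lemma computable_pfst [comp_intros]:
  assumes "computable f" shows "computable (\<lambda>A x. pfst (f A x))"
  by (rule computable_comp[OF _ assms]) (rule computableI[of Fst], simp)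

lemma computable_psnd [comp_intros]:
  assumes "computable f" shows "computable (\<lambda>A x. psnd (f A x))"
  by (rule computable_comp[OF _ assms]) (rule computableI[of Snd], simp)

lemma computable_pair [comp_intros]:
  assumes "computable f" "computable g"
  shows "computable (\<lambda>A x. prod_encode (f A x, g A x))"
proof -
  from assms obtain a b where "\<And>A x. run A a x = Some (f A x)" "\<And>A x. run A b x = Some (g A x)"
    unfolding computable_def by blast
  then show ?thesis by (intro computableI[of "Pair a b"]) simp
qed

lemma computable_comp2:
  assumes "computable (\<lambda>A z. h A (pfst z) (psnd z))" "computable f" "computable g"
  shows "computable (\<lambda>A x. h A (f A x) (g A x))"
  using computable_comp[OF assms(1) computable_pair[OF assms(2,3)]] by simp

text \<open>\<open>Prec\<close> hands the parameter \<open>x\<close> on unchanged, so base and step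
  may both depend on it. The arithmetic rules below reduce to this scheme.\<close>

lemma computable_rec_nat:
  assumes "computable b" "computable n"
    and "computable (\<lambda>A z. s A (pfst z) (pfst (psnd z)) (psnd (psnd z)))"
  shows "computable (\<lambda>A x. rec_nat (b A x) (s A x) (n A x))"
proof -
  from assms obtain eb en es where e:
    "\<And>A x. run A eb x = Some (b A x)" "\<And>A x. run A en x = Some (n A x)"
    "\<And>A z. run A es z = Some (s A (pfst z) (pfst (psnd z)) (psnd (psnd z)))"
    unfolding computable_def by blast
  have "rec_nat (Some (b A x))
      (\<lambda>k r. Option.bind r (\<lambda>y. run A es (prod_encode (x, prod_encode (k, y))))) m
      = Some (rec_nat (b A x) (s A x) m)" for A x m
    by (induction m) (simp_all add: e)
  then show ?thesis
    by (intro computableI[of "Comp (Prec eb es) (Pair (Pair Fst Snd) en)"]) (simp add: e)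
qed

lemma computable_add [comp_intros]:
  assumes "computable f" "computable g" shows "computable (\<lambda>A x. f A x + g A x)"
proof -
  have "computable (\<lambda>A x. rec_nat (g A x) (\<lambda>_ r. Suc r) (f A x))"
    by (intro computable_rec_nat assms comp_intros)
  moreover have "rec_nat b (\<lambda>_ r. Suc r) n = n + b" for b n
    by (induction n) auto
  ultimately show ?thesis by simp
qed

text \<open>Truncated subtraction iterates the predecessor, which is itself the recursion that
  returns its own counter.\<close>

lemma computable_diff [comp_intros]:
  assumes "computable f" "computable g" shows "computable (\<lambda>A x. f A x - g A x)"
proof -
  have "computable (\<lambda>A x. rec_nat 0 (\<lambda>k _. k) x)"
    by (intro computable_rec_nat comp_intros)
  moreover have "rec_nat 0 (\<lambda>k _. k) x = x - 1" for x
    by (cases x) auto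
  ultimately have pred: "computable (\<lambda>A x. x - 1)" by simp
  have "computable (\<lambda>A x. rec_nat (f A x) (\<lambda>_ r. r - 1) (g A x))"
    by (intro computable_rec_nat assms computable_comp[OF pred] comp_intros)
  moreover have "rec_nat b (\<lambda>_ r. r - 1) n = b - n" for b n :: nat
    by (induction n) auto
  ultimately show ?thesis by simp
qed

lemma computable_sum [comp_intros]:
  assumes "computable (\<lambda>A z. f A (pfst z) (psnd z))" "computable n"
  shows "computable (\<lambda>A x. \<Sum>k<n A x. f A x k)"
proof -
  have "computable (\<lambda>A x. rec_nat 0 (\<lambda>k r. r + f A x k) (n A x))"
    by (intro computable_rec_nat assms computable_comp2[OF assms(1)] comp_intros)
  moreover have "rec_nat 0 (\<lambda>k r. r + g k) n = (\<Sum>k<n. g k)" for g :: "nat \<Rightarrow> nat" and n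
    by (induction n) auto
  ultimately show ?thesis by simp
qed

lemma computable_mult [comp_intros]:
  assumes "computable f" "computable g" shows "computable (\<lambda>A x. f A x * g A x)"
proof -
  have "computable (\<lambda>A x. \<Sum>k<f A x. g A x)"
    by (intro comp_intros assms computable_comp[OF assms(2)])
  then show ?thesis by simp
qed

lemma computable_power [comp_intros]:
  assumes "computable f" "computable g" shows "computable (\<lambda>A x. f A x ^ g A x)"
proof -
  have "computable (\<lambda>A x. rec_nat 1 (\<lambda>_ r. f A x * r) (g A x))"
    by (intro computable_rec_nat assms computable_comp[OF assms(1)] comp_intros)
  moreover have "rec_nat 1 (\<lambda>_ r. a * r) n = a ^ n" for a n :: nat
    by (induction n) auto
  ultimately show ?thesis by simp
qed

section \<open>Decidable predicates\<close>

lemma computable_of_bool [comp_intros]: "decidable P \<Longrightarrow> computable (\<lambda>A x. of_bool (P A x))"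
  by (simp add: decidable_def)

lemma decidable_le [comp_intros]:
  assumes "computable f" "computable g" shows "decidable (\<lambda>A x. f A x \<le> g A x)"
proof -
  have "computable (\<lambda>A x. 1 - (f A x - g A x))" by (intro comp_intros assms)
  moreover have "1 - (a - b) = of_bool (a \<le> b)" for a b :: nat by auto
  ultimately show ?thesis by (simp add: decidable_def)
qed

lemma decidable_conj [comp_intros]:
  assumes "decidable P" "decidable Q" shows "decidable (\<lambda>A x. P A x \<and> Q A x)"
proof -
  have "computable (\<lambda>A x. of_bool (P A x) * of_bool (Q A x))" by (intro comp_intros assms)
  then show ?thesis by (simp add: decidable_def of_bool_conj)
qed

lemma decidable_not [comp_intros]:
  assumes "decidable P" shows "decidable (\<lambda>A x. \<not> P A x)"
proof -
  have "computable (\<lambda>A x. 1 - of_bool (P A x))" by (intro comp_intros assms)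
  moreover have "1 - of_bool p = (of_bool (\<not> p) :: nat)" for p by auto
  ultimately show ?thesis by (simp add: decidable_def)
qed

lemma decidable_imp [comp_intros]:
  assumes "decidable P" "decidable Q" shows "decidable (\<lambda>A x. P A x \<longrightarrow> Q A x)"
proof -
  have "decidable (\<lambda>A x. \<not> (P A x \<and> \<not> Q A x))" by (intro comp_intros assms)
  then show ?thesis by (simp add: decidable_def)
qed

lemma decidable_less [comp_intros]:
  assumes "computable f" "computable g" shows "decidable (\<lambda>A x. f A x < g A x)"
  using decidable_le[OF computable_Suc[OF assms(1)] assms(2)] by (simp add: Suc_le_eq)

lemma decidable_eq [comp_intros]:
  assumes "computable f" "computable g" shows "decidable (\<lambda>A x. f A x = g A x)"
proof -
  have "decidable (\<lambda>A x. f A x \<le> g A x \<and> g A x \<le> f A x)" by (intro comp_intros assms)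
  then show ?thesis by (simp add: eq_iff[symmetric] antisym_conv)
qed

lemma decidable_ball [comp_intros]:
  assumes "decidable (\<lambda>A z. P A (pfst z) (psnd z))" "computable n"
  shows "decidable (\<lambda>A x. \<forall>k<n A x. P A x k)"
proof -
  have "decidable (\<lambda>A x. (\<Sum>k<n A x. of_bool (\<not> P A x k)) = (0 :: nat))"
    by (intro comp_intros assms)
  moreover have "(\<Sum>k<m. of_bool (\<not> p k)) = (0 :: nat) \<longleftrightarrow> (\<forall>k<m. p k)" for p and m :: nat
    by (subst sum_eq_0_iff) auto
  ultimately show ?thesis by (simp only:)
qed

lemma computable_if [comp_intros]:
  assumes "decidable P" "computable f" "computable g"
  shows "computable (\<lambda>A x. if P A x then f A x else g A x)"
proof -
  have "computable (\<lambda>A x. of_bool (P A x) * f A x + of_bool (\<not> P A x) * g A x)"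
    by (intro comp_intros assms)
  moreover have "of_bool p * a + of_bool (\<not> p) * b = (if p then a else b)" for p and a b :: nat
    by auto
  ultimately show ?thesis by simp
qed

text \<open>The quotient counts the positive multiples of the divisor up to the dividend. The guard
  gives division by \<open>0\<close> its value \<open>0\<close>.\<close>

lemma computable_div [comp_intros]:
  assumes "computable f" "computable g" shows "computable (\<lambda>A x. f A x div g A x)"
proof -
  have "computable (\<lambda>A x. \<Sum>k<f A x. of_bool (0 < g A x \<and> Suc k * g A x \<le> f A x))"
    by (intro comp_intros assms computable_comp[OF assms(1)] computable_comp[OF assms(2)])
  moreover have "(\<Sum>k<a. of_bool (0 < b \<and> Suc k * b \<le> a)) = a div b" for a b :: nat
  proof (cases "b = 0")
    case False
    then have "k < a \<and> 0 < b \<and> Suc k * b \<le> a \<longleftrightarrow> k < a div b" for k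
      by (metis Suc_le_eq div_le_dividend less_eq_div_iff_mult_less_eq neq0_conv order_less_le_trans)
    then have "{k. k < a} \<inter> {k. 0 < b \<and> Suc k * b \<le> a} = {..<a div b}" by auto
    then show ?thesis by (simp add: lessThan_def sum.If_cases of_bool_def flip: Collect_conj_eq)
  qed auto
  ultimately show ?thesis by simp
qed

lemma decidable_even [comp_intros]:
  assumes "computable f" shows "decidable (\<lambda>A x. even (f A x))"
proof -
  have "decidable (\<lambda>A x. f A x - 2 * (f A x div 2) = 0)" by (intro comp_intros assms)
  moreover have "(a - 2 * (a div 2) = 0) = even a" for a :: nat
    by presburger
  ultimately show ?thesis by simp
qed

section \<open>Semicomputation\<close>

text \<open>\<open>Mu\<close> looks for a zero, so it runs on the characteristic function of the
  negation of \<open>P\<close>. Decidability of \<open>P\<close> settles its convergence clause; the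
  least witness is then handed to \<open>h\<close>.\<close>

lemma computable_search:
  assumes "decidable (\<lambda>A z. P A (pfst z) (psnd z))" "computable (\<lambda>A z. h A (pfst z) (psnd z))"
  shows "\<exists>e. \<forall>A x. run A e x =
    (if \<exists>r. P A x r then Some (h A x (LEAST r. P A x r)) else None)"
proof -
  obtain a where a: "run A a z = Some (of_bool (\<not> P A (pfst z) (psnd z)))" for A z
    using decidable_not[OF assms(1)] unfolding decidable_def computable_def by blast
  obtain b where b: "run A b z = Some (h A (pfst z) (psnd z))" for A z
    using assms(2) unfolding computable_def by blast
  have "run A (Comp b (Pair (Pair Fst Snd) (Mu a))) x =
      (if \<exists>r. P A x r then Some (h A x (LEAST r. P A x r)) else None)" for A x
    by (auto simp: a b mu_search_def)
  then show ?thesis by blast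
qed

lemma computable_mu:
  assumes "decidable (\<lambda>A z. P A (pfst z) (psnd z))"
  shows "\<exists>e. \<forall>A x. run A e x \<noteq> None \<longleftrightarrow> (\<exists>r. P A x r)"
proof -
  obtain e where "\<forall>A x. run A e x = (if \<exists>r. P A x r then Some 0 else None)"
    using computable_search[OF assms, of "\<lambda>_ _ _. 0"] by (auto intro: comp_intros)
  then show ?thesis by (intro exI[of _ e]) auto
qed

text \<open>
  Stage \<open>s\<close> of a computation on \<open>x\<close>: the value \<open>0\<close> means that it is still running, \<open>Suc y\<close> that it
  has halted with output \<open>y\<close>. The bound is on the depth of unbounded searches only, which suffices
  to make every stage total.
\<close>

definition approximates :: "(cantor \<Rightarrow> nat \<Rightarrow> nat) \<Rightarrow> prog \<Rightarrow> bool" where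
  "approximates g e \<longleftrightarrow> computable g \<and>
    (\<forall>A x s s' y. g A (prod_encode (x, s)) = Suc y \<longrightarrow> s \<le> s' \<longrightarrow> g A (prod_encode (x, s')) = Suc y) \<and>
    (\<forall>A x y. run A e x = Some y \<longleftrightarrow> (\<exists>s. g A (prod_encode (x, s)) = Suc y))"

lemma approximates_total:
  assumes "\<And>A x. run A e x \<noteq> None"
  shows "\<exists>g. approximates g e"
proof -
  define f where "f A x = the (run A e x)" for A x
  have e: "run A e x = Some (f A x)" for A x using assms[of A x] by (auto simp: f_def)
  then have f: "computable f" by (rule computableI)
  have "computable (\<lambda>A z. Suc (f A (pfst z)))"
    by (intro comp_intros computable_comp[OF f])
  then show ?thesis
    by (intro exI[of _ "\<lambda>A z. Suc (f A (pfst z))"]) (auto simp: approximates_def e)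
qed

lemma approximatesD:
  assumes "approximates g e"
  shows "computable g"
    and "\<And>A x s s' y. g A (prod_encode (x, s)) = Suc y \<Longrightarrow> s \<le> s' \<Longrightarrow> g A (prod_encode (x, s')) = Suc y"
    and "\<And>A x y. run A e x = Some y \<longleftrightarrow> (\<exists>s. g A (prod_encode (x, s)) = Suc y)"
  using assms unfolding approximates_def by blast+

lemma approximates_halts:
  assumes "approximates g e"
  shows "run A e x \<noteq> None \<longleftrightarrow> (\<exists>s. 0 < g A (prod_encode (x, s)))"
proof -
  have "run A e x \<noteq> None \<longleftrightarrow> (\<exists>y. run A e x = Some y)" by blast
  then show ?thesis unfolding approximatesD(3)[OF assms] gr0_conv_Suc by blast
qed

lemma approximates_halts_mono:
  assumes "approximates g e" "0 < g A (prod_encode (x, s))" "s \<le> s'"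
  shows "0 < g A (prod_encode (x, s'))"
  using approximatesD(2)[OF assms(1) _ assms(3)] assms(2) unfolding gr0_conv_Suc by blast

lemma approximatesI:
  assumes "computable (\<lambda>A z. h A (pfst z) (psnd z))"
    and "\<And>A x s s' y. h A x s = Suc y \<Longrightarrow> s \<le> s' \<Longrightarrow> h A x s' = Suc y"
    and "\<And>A x y s. h A x s = Suc y \<Longrightarrow> run A e x = Some y"
    and "\<And>A x y. run A e x = Some y \<Longrightarrow> \<exists>s. h A x s = Suc y"
  shows "\<exists>g. approximates g e"
  unfolding approximates_def
  by (rule exI[of _ "\<lambda>A z. h A (pfst z) (psnd z)"], unfold prod_encode_inverse fst_conv snd_conv)
    (use assms in blast)

lemma approximates_Pair:
  assumes f: "approximates f a" and g: "approximates g b"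
  shows "\<exists>h. approximates h (Pair a b)"
proof (rule approximatesI)
  let ?h = "\<lambda>A x s. if 0 < f A (prod_encode (x, s)) \<and> 0 < g A (prod_encode (x, s))
    then Suc (prod_encode (f A (prod_encode (x, s)) - 1, g A (prod_encode (x, s)) - 1)) else 0"
  note f = approximatesD[OF f] and g = approximatesD[OF g]
  show "computable (\<lambda>A z. ?h A (pfst z) (psnd z))"
    by (intro comp_intros computable_comp[OF f(1)] computable_comp[OF g(1)])
  have h: "?h A x s = Suc y \<longleftrightarrow>
      (\<exists>u v. f A (prod_encode (x, s)) = Suc u \<and> g A (prod_encode (x, s)) = Suc v \<and> y = prod_encode (u, v))"
    for A x s y
    by (auto simp: gr0_conv_Suc)
  show "?h A x s' = Suc y" if "?h A x s = Suc y" "s \<le> s'" for A x s s' y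
    using that f(2) g(2) unfolding h by blast
  show "run A (Pair a b) x = Some y" if "?h A x s = Suc y" for A x y s
  proof -
    obtain u v where "f A (prod_encode (x, s)) = Suc u" "g A (prod_encode (x, s)) = Suc v"
      and y: "y = prod_encode (u, v)"
      using \<open>?h A x s = Suc y\<close>[unfolded h] by blast
    then have "run A a x = Some u" "run A b x = Some v"
      using f(3) g(3) by blast+
    then show ?thesis using y by simp
  qed
  show "\<exists>s. ?h A x s = Suc y" if y: "run A (Pair a b) x = Some y" for A x y
  proof -
    obtain u v where "run A a x = Some u" "run A b x = Some v" and y: "y = prod_encode (u, v)"
      using y by (auto simp: Option.bind_eq_Some_conv)
    then obtain s t where "f A (prod_encode (x, s)) = Suc u" "g A (prod_encode (x, t)) = Suc v"
      using f(3) g(3) by blast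
    \<comment> \<open>Values persist, so both computations can be read off at the later of the two
      stages.\<close>
    then have "f A (prod_encode (x, max s t)) = Suc u" "g A (prod_encode (x, max s t)) = Suc v"
      using f(2)[of A x s u "max s t"] g(2)[of A x t v "max s t"] by simp_all
    then show ?thesis using y unfolding h by blast
  qed
qed

lemma approximates_Comp:
  assumes f: "approximates f a" and g: "approximates g b"
  shows "\<exists>h. approximates h (Comp a b)"
proof (rule approximatesI)
  let ?h = "\<lambda>A x s. if 0 < g A (prod_encode (x, s))
    then f A (prod_encode (g A (prod_encode (x, s)) - 1, s)) else 0"
  note f = approximatesD[OF f] and g = approximatesD[OF g]
  show "computable (\<lambda>A z. ?h A (pfst z) (psnd z))"
    by (intro comp_intros computable_comp[OF f(1)] computable_comp[OF g(1)])
  have h: "?h A x s = Suc y \<longleftrightarrow>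
      (\<exists>u. g A (prod_encode (x, s)) = Suc u \<and> f A (prod_encode (u, s)) = Suc y)"
    for A x s y
    by (auto simp: gr0_conv_Suc)
  show "?h A x s' = Suc y" if "?h A x s = Suc y" "s \<le> s'" for A x s s' y
    using that f(2) g(2) unfolding h by blast
  show "run A (Comp a b) x = Some y" if "?h A x s = Suc y" for A x y s
    using that f(3) g(3) unfolding h run.simps Option.bind_eq_Some_conv by blast
  show "\<exists>s. ?h A x s = Suc y" if y: "run A (Comp a b) x = Some y" for A x y
  proof -
    obtain u where "run A b x = Some u" "run A a u = Some y"
      using y by (auto simp: Option.bind_eq_Some_conv)
    then obtain s t where "g A (prod_encode (x, s)) = Suc u" "f A (prod_encode (u, t)) = Suc y"
      using f(3) g(3) by blast
    then have "g A (prod_encode (x, max s t)) = Suc u" "f A (prod_encode (u, max s t)) = Suc y"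
      using g(2)[of A x s u "max s t"] f(2)[of A u t y "max s t"] by simp_all
    then show ?thesis unfolding h by blast
  qed
qed

lemma approximates_Prec:
  assumes f: "approximates f a" and g: "approximates g b"
  shows "\<exists>h. approximates h (Prec a b)"
proof (rule approximatesI)
  \<comment> \<open>Every step of the recursion gets the same stage \<open>s\<close>; the value
    \<open>0\<close> of an unfinished step propagates to all later ones.\<close>
  define r where "r A x s = rec_nat (f A (prod_encode (x, s)))
    (\<lambda>k r. if 0 < r then g A (prod_encode (prod_encode (x, prod_encode (k, r - 1)), s)) else 0)"
    for A x s
  let ?h = "\<lambda>A x s. r A (pfst x) s (psnd x)"
  note f = approximatesD[OF f] and g = approximatesD[OF g]
  show "computable (\<lambda>A z. ?h A (pfst z) (psnd z))"
    unfolding r_def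
    by (intro comp_intros computable_rec_nat computable_comp[OF f(1)] computable_comp[OF g(1)])
  have r_0: "r A x s 0 = f A (prod_encode (x, s))" for A x s
    by (simp add: r_def)
  have r_Suc: "r A x s (Suc k) = Suc y \<longleftrightarrow> (\<exists>u. r A x s k = Suc u \<and>
      g A (prod_encode (prod_encode (x, prod_encode (k, u)), s)) = Suc y)" for A x s k y
    by (auto simp: r_def gr0_conv_Suc)
  have mono: "r A x s' k = Suc y" if "r A x s k = Suc y" "s \<le> s'" for A x s s' k y
    using that
  proof (induction k arbitrary: y)
    case 0
    then show ?case using f(2) unfolding r_0 by blast
  next
    case (Suc k)
    then show ?case using g(2) unfolding r_Suc by blast
  qed
  then show "?h A x s' = Suc y" if "?h A x s = Suc y" "s \<le> s'" for A x s s' y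
    using that by blast
  let ?R = "\<lambda>A x k. rec_nat (run A a x)
      (\<lambda>k r. Option.bind r (\<lambda>y. run A b (prod_encode (x, prod_encode (k, y))))) k"
  have R: "?R A x k = Some y \<longleftrightarrow> (\<exists>s. r A x s k = Suc y)" for A x k y
  proof (induction k arbitrary: y)
    case 0
    then show ?case using f(3) by (simp add: r_0)
  next
    case (Suc k)
    show ?case
    proof
      assume "?R A x (Suc k) = Some y"
      then obtain u where "?R A x k = Some u"
        and "run A b (prod_encode (x, prod_encode (k, u))) = Some y"
        by (auto simp: Option.bind_eq_Some_conv)
      then obtain s t where "r A x s k = Suc u"
        and "g A (prod_encode (prod_encode (x, prod_encode (k, u)), t)) = Suc y"
        using Suc g(3) by blast
      then have "r A x (max s t) k = Suc u"
        and "g A (prod_encode (prod_encode (x, prod_encode (k, u)), max s t)) = Suc y"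
        using mono[of A x s k u "max s t"] g(2)[of A _ t y "max s t"] by simp_all
      then show "\<exists>s. r A x s (Suc k) = Suc y"
        unfolding r_Suc by blast
    next
      assume "\<exists>s. r A x s (Suc k) = Suc y"
      then obtain s u where "r A x s k = Suc u"
        and "g A (prod_encode (prod_encode (x, prod_encode (k, u)), s)) = Suc y"
        unfolding r_Suc by blast
      then have "?R A x k = Some u" "run A b (prod_encode (x, prod_encode (k, u))) = Some y"
        using Suc g(3) by blast+
      then show "?R A x (Suc k) = Some y" by simp
    qed
  qed
  show "run A (Prec a b) x = Some y" if "?h A x s = Suc y" for A x y s
    using that R by auto
  show "\<exists>s. ?h A x s = Suc y" if "run A (Prec a b) x = Some y" for A x y
    using that R by auto
qed

text \<open>Leastness turns definedness below \<open>n\<close> into definedness with a positive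
  value, a condition without \<open>LEAST\<close> that finite stages can confirm.\<close>

lemma mu_search_eq_Some_iff:
  "mu_search \<phi> = Some n \<longleftrightarrow> \<phi> n = Some 0 \<and> (\<forall>m<n. \<exists>y. \<phi> m = Some (Suc y))"
proof -
  define P where "P n \<longleftrightarrow> \<phi> n = Some 0 \<and> (\<forall>m<n. \<phi> m \<noteq> None)" for n
  have mu: "mu_search \<phi> = (if \<exists>n. P n then Some (LEAST n. P n) else None)"
    by (simp add: mu_search_def P_def)
  show ?thesis
  proof
    assume "mu_search \<phi> = Some n"
    then have ex: "\<exists>n. P n" and n: "n = (LEAST n. P n)"
      by (auto simp: mu split: if_splits)
    have "P n" using LeastI_ex[OF ex] n by simp
    have "\<exists>y. \<phi> m = Some (Suc y)" if "m < n" for m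
    proof -
      have "\<not> P m" using not_less_Least[of m P] n that by simp
      moreover have "\<forall>i<m. \<phi> i \<noteq> None" using \<open>P n\<close> that by (auto simp: P_def)
      ultimately have "\<phi> m \<noteq> Some 0" by (simp add: P_def)
      moreover obtain y where "\<phi> m = Some y" using \<open>P n\<close> \<open>m < n\<close> by (auto simp: P_def)
      ultimately show ?thesis by (cases y) auto
    qed
    then show "\<phi> n = Some 0 \<and> (\<forall>m<n. \<exists>y. \<phi> m = Some (Suc y))"
      using \<open>P n\<close> by (simp add: P_def)
  next
    assume n: "\<phi> n = Some 0 \<and> (\<forall>m<n. \<exists>y. \<phi> m = Some (Suc y))"
    then have "P n" by (auto simp: P_def)
    moreover have "n \<le> m" if "P m" for m
    proof (rule ccontr)
      assume "\<not> n \<le> m"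
      then have "m < n" by simp
      then obtain y where "\<phi> m = Some (Suc y)" using n by blast
      then show False using \<open>P m\<close> by (simp add: P_def)
    qed
    ultimately have "(LEAST n. P n) = n" by (rule Least_equality)
    then show "mu_search \<phi> = Some n" using \<open>P n\<close> by (auto simp: mu)
  qed
qed

lemma approximates_Mu:
  assumes f: "approximates f a"
  shows "\<exists>h. approximates h (Mu a)"
proof (rule approximatesI)
  let ?f = "\<lambda>A x s n. f A (prod_encode (prod_encode (x, n), s))"
  \<comment> \<open>\<open>r A x s k\<close> is the least \<open>n < k\<close> with \<open>?f A x s n < 2\<close>, if there is one, and \<open>k\<close> otherwise.\<close>
  define r where "r A x s = rec_nat 0 (\<lambda>k r. if r = k \<and> 2 \<le> ?f A x s k then Suc k else r)" for A x s
  \<comment> \<open>The value \<open>1\<close> means halting with output \<open>0\<close>, and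
    values from \<open>2\<close> on mean halting with a positive output. So the search succeeds if
    the first value below \<open>2\<close> is \<open>1\<close>, and is still waiting if it is
    \<open>0\<close>.\<close>
  let ?h = "\<lambda>A x s. if ?f A x s (r A x s s) = 1 then Suc (r A x s s) else 0"
  note f = approximatesD[OF f]
  show "computable (\<lambda>A z. ?h A (pfst z) (psnd z))"
    unfolding r_def
    by (intro comp_intros computable_rec_nat computable_comp[OF f(1)])
  have r: "r A x s k \<le> k \<and> (\<forall>m<r A x s k. 2 \<le> ?f A x s m) \<and>
      (r A x s k < k \<longrightarrow> \<not> 2 \<le> ?f A x s (r A x s k))" for A x s k
    by (induction k) (auto simp: r_def less_Suc_eq)
  have h: "?h A x s = Suc n \<longleftrightarrow> n \<le> s \<and> ?f A x s n = 1 \<and> (\<forall>m<n. 2 \<le> ?f A x s m)" for A x s n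
  proof
    assume "?h A x s = Suc n"
    then show "n \<le> s \<and> ?f A x s n = 1 \<and> (\<forall>m<n. 2 \<le> ?f A x s m)"
      using r[of A x s s] by (auto split: if_splits)
  next
    assume n: "n \<le> s \<and> ?f A x s n = 1 \<and> (\<forall>m<n. 2 \<le> ?f A x s m)"
    then have "\<not> n < r A x s s" using r[of A x s s] by force
    moreover have "\<not> r A x s s < n" using n r[of A x s s] by force
    ultimately have "r A x s s = n" by simp
    then show "?h A x s = Suc n" using n by simp
  qed
  have mono: "?f A x s' n = Suc y" if "?f A x s n = Suc y" "s \<le> s'" for A x s s' n y
    using f(2) that by blast
  have mono2: "2 \<le> ?f A x s' n" if "2 \<le> ?f A x s n" "s \<le> s'" for A x s s' n
    using mono[where A = A and x = x and n = n and s = s and s' = s' and y = "?f A x s n - 1"] that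
    by simp
  show "?h A x s' = Suc y" if "?h A x s = Suc y" "s \<le> s'" for A x s s' y
    using that mono[where A = A and x = x and s = s and s' = s' and n = y and y = 0]
      mono2[where A = A and x = x and s = s and s' = s'] unfolding h by simp
  show "run A (Mu a) x = Some y" if hs: "?h A x s = Suc y" for A x y s
  proof -
    have y: "?f A x s y = Suc 0" and less: "\<And>m. m < y \<Longrightarrow> 2 \<le> ?f A x s m"
      using hs unfolding h by simp_all
    have "run A a (prod_encode (x, y)) = Some 0"
      using y f(3) by blast
    moreover have "\<exists>v. run A a (prod_encode (x, m)) = Some (Suc v)" if "m < y" for m
    proof -
      have "?f A x s m = Suc (Suc (?f A x s m - 2))" using less[OF that] by simp
      then show ?thesis using f(3) by blast
    qed
    ultimately show ?thesis by (simp add: mu_search_eq_Some_iff)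
  qed
  show "\<exists>s. ?h A x s = Suc y" if "run A (Mu a) x = Some y" for A x y
  proof -
    from that have 0: "run A a (prod_encode (x, y)) = Some 0"
      and m: "\<forall>m<y. \<exists>v. run A a (prod_encode (x, m)) = Some (Suc v)"
      by (auto simp: mu_search_eq_Some_iff)
    obtain s where s: "?f A x s y = Suc 0" using 0 f(3) by blast
    have "\<forall>m<y. \<exists>t v. ?f A x t m = Suc (Suc v)" using m f(3) by blast
    then obtain t where t: "\<And>m. m < y \<Longrightarrow> \<exists>v. ?f A x (t m) m = Suc (Suc v)"
      by metis
    \<comment> \<open>Finitely many stages have a common bound. It must also reach \<open>y\<close>,
      since stage \<open>u\<close> searches no further than \<open>u\<close>.\<close>
    define u where "u = Max (insert s (insert y (t ` {..<y})))"
    have "s \<le> u" "y \<le> u" and tu: "\<And>m. m < y \<Longrightarrow> t m \<le> u"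
      unfolding u_def by (intro Max_ge; simp)+
    moreover have "?f A x u y = 1" using mono[OF s \<open>s \<le> u\<close>] by simp
    moreover have "2 \<le> ?f A x u m" if "m < y" for m
    proof -
      obtain v where "?f A x (t m) m = Suc (Suc v)" using t[OF \<open>m < y\<close>] by blast
      then have "?f A x u m = Suc (Suc v)"
        using mono tu[OF \<open>m < y\<close>] by blast
      then show ?thesis by simp
    qed
    ultimately show ?thesis unfolding h by blast
  qed
qed

text \<open>This does the work of a step-counting evaluator: uniformly in the oracle, the graph of a
  program becomes the projection of a decidable relation.\<close>

theorem approximation_exists: "\<exists>g. approximates g e"
proof (induction e)
  case (Pair a b)
  then show ?case using approximates_Pair by blast
next
  case (Comp a b)
  then show ?case using approximates_Comp by blast
next
  case (Prec a b)
  then show ?case using approximates_Prec by blast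
next
  case (Mu a)
  then show ?case using approximates_Mu by blast
qed (rule approximates_total, simp)+

section \<open>Binary strings\<close>

text \<open>The most significant bit comes first, so that taking a prefix is integer division and,
  for \<open>v < 2 ^ m\<close>, the string names the dyadic interval from \<open>v / 2 ^ m\<close>
  to \<open>(v + 1) / 2 ^ m\<close>.\<close>

primrec bits :: "nat \<Rightarrow> nat \<Rightarrow> bool list" where
  "bits v 0 = []"
| "bits v (Suc m) = odd (v div 2 ^ m) # bits v m"

lemma length_bits [simp]: "length (bits v m) = m"
  by (induction m) auto

lemma nth_bits: "i < m \<Longrightarrow> bits v m ! i = odd (v div 2 ^ (m - Suc i))"
  by (induction m arbitrary: i) (auto simp: nth_Cons' Suc_diff_Suc)

lemma take_bits: "p \<le> m \<Longrightarrow> take p (bits v m) = bits (v div 2 ^ (m - p)) p"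
  by (rule nth_equalityI) (auto simp: nth_bits div_mult2_eq[symmetric] power_add[symmetric])

lemma bits_mod: "bits (v mod 2 ^ m) m = bits v m"
proof (rule nth_equalityI)
  fix i assume "i < length (bits (v mod 2 ^ m) m)"
  then have "i < m" by simp
  then have "odd (v mod 2 ^ m div 2 ^ (m - Suc i)) = odd (v div 2 ^ (m - Suc i))"
    using bit_take_bit_iff[of m v "m - Suc i"]
    by (simp add: bit_iff_odd take_bit_eq_mod)
  with \<open>i < m\<close> show "bits (v mod 2 ^ m) m ! i = bits v m ! i"
    by (simp add: nth_bits)
qed simp

lemma bits_inj:
  assumes "bits v m = bits w m" "v < 2 ^ m" "w < 2 ^ m"
  shows "v = w"
  using assms
proof (induction m arbitrary: v w)
  case (Suc m)
  have *: "u = (u div 2 ^ m) * 2 ^ m + u mod 2 ^ m" "u div 2 ^ m < 2" if "u < 2 ^ Suc m" for u :: nat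
    using that by (simp_all only: div_mult_mod_eq power_Suc less_mult_imp_div_less)
  have "bits (v mod 2 ^ m) m = bits (w mod 2 ^ m) m"
    using Suc.prems(1) by (simp add: bits_mod)
  then have "v mod 2 ^ m = w mod 2 ^ m" by (rule Suc.IH) auto
  moreover have "v div 2 ^ m = w div 2 ^ m"
    using Suc.prems(1) *(2)[OF Suc.prems(2)] *(2)[OF Suc.prems(3)] by (auto simp: less_2_cases_iff)
  ultimately show ?case using *(1)[OF Suc.prems(2)] *(1)[OF Suc.prems(3)] by metis
qed simp

lemma bits_surj: "\<exists>v<2 ^ length \<sigma>. bits v (length \<sigma>) = \<sigma>"
proof (induction \<sigma>)
  case (Cons b \<sigma>)
  then obtain v where v: "v < 2 ^ length \<sigma>" "bits v (length \<sigma>) = \<sigma>" by blast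
  let ?w = "of_bool b * 2 ^ length \<sigma> + v"
  have "bits ?w (length \<sigma>) = bits (?w mod 2 ^ length \<sigma>) (length \<sigma>)" by (simp only: bits_mod)
  also have "?w mod 2 ^ length \<sigma> = v" using v(1) by simp
  finally have "bits ?w (length (b # \<sigma>)) = b # \<sigma>" using v by simp
  moreover have "?w < 2 ^ length (b # \<sigma>)" using v(1) by (cases b) auto
  ultimately show ?case by blast
qed simp

lemma str_code_inj: "str_code \<sigma> = str_code \<tau> \<longleftrightarrow> \<sigma> = \<tau>"
proof
  assume "str_code \<sigma> = str_code \<tau>"
  then have "map of_bool \<sigma> = (map of_bool \<tau> :: nat list)"
    unfolding str_code_def by (simp add: inj_eq[OF inj_list_encode])
  then show "\<sigma> = \<tau>" by (rule map_injective) (auto simp: inj_def)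
qed simp

text \<open>\<open>list_encode\<close> of a cons is \<open>Suc\<close> of a pair, so recursion on
  the length puts the next higher bit in front. Decoding is avoided throughout: searches guess a
  value and a length and compare codes.\<close>

lemma computable_str_code [comp_intros]:
  assumes "computable v" "computable m"
  shows "computable (\<lambda>A x. str_code (bits (v A x) (m A x)))"
proof -
  have "computable (\<lambda>A x. rec_nat 0
      (\<lambda>k r. Suc (prod_encode (of_bool (odd (v A x div 2 ^ k)), r))) (m A x))"
    by (intro computable_rec_nat assms comp_intros computable_comp[OF assms(1)])
  moreover have "rec_nat 0 (\<lambda>k r. Suc (prod_encode (of_bool (odd (w div 2 ^ k)), r))) n
      = str_code (bits w n)" for w n
    by (induction n) (simp_all add: str_code_def)
  ultimately show ?thesis by simp
qed

section \<open>Coin-tossing measure\<close>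

lemma prob_space_coin: "prob_space coin_measure"
  unfolding coin_measure_def by (intro prob_space_PiM prob_space_measure_pmf)

interpretation coin: prob_space coin_measure
  by (rule prob_space_coin)

lemma space_coin [simp]: "space coin_measure = UNIV"
  by (simp add: coin_measure_def space_PiM)

lemma coord_measurable [measurable]: "(\<lambda>X. X j) \<in> measurable coin_measure (count_space UNIV)"
  unfolding coin_measure_def
  using measurable_component_singleton[of j UNIV "\<lambda>_. measure_pmf (bernoulli_pmf (1/2))"]
  by simp

lemma initial_segment_iff: "initial_segment \<sigma> X \<longleftrightarrow> (\<forall>i<length \<sigma>. X i = \<sigma> ! i)"
  unfolding initial_segment_def list_eq_iff_nth_eq by simp

lemma coord_eq_measurable [measurable]: "Measurable.pred coin_measure (\<lambda>X. X j = b)"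
  using coord_measurable[of j] by (cases b) simp_all

lemma initial_segment_measurable [measurable]: "Measurable.pred coin_measure (\<lambda>X. initial_segment \<sigma> X)"
  unfolding initial_segment_iff by (intro pred_intros_countable pred_intros_imp' coord_eq_measurable)

lemma Collect_sets_coin: "Measurable.pred coin_measure P \<Longrightarrow> {X. P X} \<in> sets coin_measure"
  by (simp add: pred_def)

lemma cylinder_sets [simp]: "{X. initial_segment \<sigma> X} \<in> sets coin_measure"
  by (rule Collect_sets_coin) (rule initial_segment_measurable)

lemma measure_coords:
  assumes "finite J"
  shows "measure coin_measure {X. \<forall>j\<in>J. X j = b j} = (1/2) ^ card J"
proof -
  interpret product_prob_space "\<lambda>_::nat. measure_pmf (bernoulli_pmf (1/2))" UNIV
    by unfold_locales
  have "measure (measure_pmf (bernoulli_pmf (1/2))) {c} = 1/2" for c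
    by (cases c) (simp_all add: measure_pmf_single)
  then have "(\<Prod>j\<in>J. measure (measure_pmf (bernoulli_pmf (1/2))) {b j}) = (1/2) ^ card J"
    by (simp only: prod_constant)
  moreover have "measure coin_measure (prod_emb UNIV (\<lambda>_. measure_pmf (bernoulli_pmf (1/2))) J (Pi\<^sub>E J (\<lambda>j. {b j})))
      = (\<Prod>j\<in>J. measure (measure_pmf (bernoulli_pmf (1/2))) {b j})"
    unfolding coin_measure_def using assms by (intro measure_PiM_emb) auto
  moreover have "prod_emb UNIV (\<lambda>_. measure_pmf (bernoulli_pmf (1/2))) J (Pi\<^sub>E J (\<lambda>j. {b j}))
      = {X. \<forall>j\<in>J. X j = b j}"
    by (rule set_eqI) (simp add: prod_emb_def PiE_iff)
  ultimately show ?thesis by simp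
qed

lemma measure_initial_segment: "measure coin_measure {X. initial_segment \<sigma> X} = (1/2) ^ length \<sigma>"
  using measure_coords[of "{..<length \<sigma>}" "\<lambda>i. \<sigma> ! i"]
  by (simp add: initial_segment_iff Ball_def)

lemma prefix_predicate_eq:
  "{X. P (map X [0..<L])} =
    (\<Union>v\<in>{v. v < 2 ^ L \<and> P (bits v L)}. {X. initial_segment (bits v L) X})"
proof safe
  fix X :: cantor assume "P (map X [0..<L])"
  moreover obtain v where "v < 2 ^ L" "bits v L = map X [0..<L]"
    using bits_surj[of "map X [0..<L]"] by auto
  ultimately show "X \<in> (\<Union>v\<in>{v. v < 2 ^ L \<and> P (bits v L)}. {X. initial_segment (bits v L) X})"
    by (auto simp: initial_segment_def)
qed (auto simp: initial_segment_def)

lemma prefix_predicate_sets: "{X. P (map X [0..<L])} \<in> sets coin_measure"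
  unfolding prefix_predicate_eq by (intro sets.finite_UN) auto

text \<open>The cylinders in the decomposition are disjoint and of equal measure. The measure of a
  clopen class thus becomes a count that a program can carry out.\<close>

lemma measure_prefix_predicate:
  "measure coin_measure {X. P (map X [0..<L])} = real (card {v. v < 2 ^ L \<and> P (bits v L)}) / 2 ^ L"
proof -
  let ?I = "{v. v < 2 ^ L \<and> P (bits v L)}"
  have "measure coin_measure (\<Union>v\<in>?I. {X. initial_segment (bits v L) X}) =
      (\<Sum>v\<in>?I. measure coin_measure {X. initial_segment (bits v L) X})"
  proof (rule coin.finite_measure_finite_Union)
    show "finite ?I" by simp
    show "disjoint_family_on (\<lambda>v. {X. initial_segment (bits v L) X}) ?I"
      by (auto simp: disjoint_family_on_def initial_segment_def dest: bits_inj)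
  qed auto
  also have "\<dots> = real (card ?I) / 2 ^ L"
    by (simp add: measure_initial_segment power_one_over)
  finally show ?thesis unfolding prefix_predicate_eq .
qed

lemma prefix_of_initial_segment:
  assumes "initial_segment \<sigma> X" "length \<sigma> \<le> n"
  shows "prefix \<sigma> (map X [0..<n])"
proof -
  have "take (length \<sigma>) (map X [0..<n]) = \<sigma>"
    using assms by (simp add: initial_segment_def take_map)
  then show ?thesis by (metis take_is_prefix)
qed

text \<open>Strings of a prefix-free set generate pairwise disjoint cylinders, whose measures add up
  to at most \<open>1\<close>.\<close>

lemma kraft:
  assumes "prefix_free S" "finite F" "F \<subseteq> S"
  shows "(\<Sum>\<sigma>\<in>F. (1/2) ^ length \<sigma>) \<le> (1::real)"
proof -
  have "disjoint_family_on (\<lambda>\<sigma>. {X. initial_segment \<sigma> X}) F"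
  proof (unfold disjoint_family_on_def, safe)
    fix \<sigma> \<tau> X assume *: "\<sigma> \<in> F" "\<tau> \<in> F" "\<sigma> \<noteq> \<tau>" "initial_segment \<sigma> X" "initial_segment \<tau> X"
    have "prefix \<sigma> (map X [0..<max (length \<sigma>) (length \<tau>)])" "prefix \<tau> (map X [0..<max (length \<sigma>) (length \<tau>)])"
      using *(4,5) by (auto intro: prefix_of_initial_segment)
    then have "prefix \<sigma> \<tau> \<or> prefix \<tau> \<sigma>" by (metis prefix_same_cases)
    then show "X \<in> {}" using * assms(1,3) unfolding prefix_free_def by blast
  qed
  then have "(\<Sum>\<sigma>\<in>F. measure coin_measure {X. initial_segment \<sigma> X}) =
      measure coin_measure (\<Union>\<sigma>\<in>F. {X. initial_segment \<sigma> X})"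
    using assms(2) by (intro coin.finite_measure_finite_Union[symmetric]) auto
  then show ?thesis by (simp add: measure_initial_segment)
qed

text \<open>
  The induction over \<open>F\<close> needs the extra block \<open>J\<close>: the event for \<open>insert i F\<close> is a difference of
  two events for \<open>F\<close>, with \<open>J\<close> and with \<open>J \<union> D i\<close>.
\<close>

lemma measure_avoid_blocks:
  fixes D :: "'i::countable \<Rightarrow> nat set"
  assumes "finite F" "finite J" "\<And>i. finite (D i)"
    and "disjoint_family_on D F" "\<And>i. i \<in> F \<Longrightarrow> D i \<inter> J = {}"
  shows "measure coin_measure {X. (\<forall>j\<in>J. \<not> X j) \<and> (\<forall>i\<in>F. \<exists>j\<in>D i. X j)}
    = (1/2) ^ card J * (\<Prod>i\<in>F. 1 - (1/2) ^ card (D i))"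
  using assms
proof (induction F arbitrary: J rule: finite_induct)
  case empty
  show ?case using measure_coords[OF empty(1), of "\<lambda>_. False"] by simp
next
  case (insert i F)
  let ?E = "\<lambda>J. {X::cantor. (\<forall>j\<in>J. \<not> X j) \<and> (\<forall>i\<in>F. \<exists>j\<in>D i. X j)}"
  have dj: "disjoint_family_on D F" using insert.prems(3) by (auto simp: disjoint_family_on_def)
  have E: "?E J \<in> sets coin_measure" for J
    unfolding Ball_def Bex_def by (intro Collect_sets_coin) measurable
  have "{X. (\<forall>j\<in>J. \<not> X j) \<and> (\<forall>i\<in>insert i F. \<exists>j\<in>D i. X j)} = ?E J - ?E (J \<union> D i)" by auto
  moreover have "measure coin_measure (?E J - ?E (J \<union> D i)) =
      measure coin_measure (?E J) - measure coin_measure (?E (J \<union> D i))"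
    by (intro coin.finite_measure_Diff E) auto
  moreover have "measure coin_measure (?E J) = (1/2) ^ card J * (\<Prod>i\<in>F. 1 - (1/2) ^ card (D i))"
    using insert.prems dj by (intro insert.IH) auto
  moreover have "measure coin_measure (?E (J \<union> D i)) =
      (1/2) ^ card (J \<union> D i) * (\<Prod>i\<in>F. 1 - (1/2) ^ card (D i))"
  proof (intro insert.IH)
    show "D k \<inter> (J \<union> D i) = {}" if "k \<in> F" for k
      using that insert.prems(3) insert.prems(4)[of k] insert.hyps(2)
      by (auto simp: disjoint_family_on_def)
  qed (use insert.prems dj in auto)
  moreover have "card (J \<union> D i) = card J + card (D i)"
    using insert.prems by (intro card_Un_disjoint) auto
  ultimately show ?case using insert.hyps by (simp add: power_add algebra_simps)
qed

text \<open>Continuity from below along the finite subfamilies cut out by \<open>to_nat\<close>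
  passes the bound on finite sums to the whole union.\<close>

lemma measure_countable_Union_le:
  fixes V :: "'i::countable \<Rightarrow> cantor set"
  assumes "\<And>i. i \<in> I \<Longrightarrow> V i \<in> sets coin_measure"
    and le: "\<And>F. finite F \<Longrightarrow> F \<subseteq> I \<Longrightarrow> (\<Sum>i\<in>F. measure coin_measure (V i)) \<le> c"
  shows "measure coin_measure (\<Union>i\<in>I. V i) \<le> c"
proof -
  let ?F = "\<lambda>n. {i \<in> I. to_nat i < n}"
  let ?W = "\<lambda>n. \<Union>i\<in>?F n. V i"
  have fin: "finite (?F n)" for n
  proof (rule finite_subset)
    show "?F n \<subseteq> to_nat -` {..<n}" by auto
    show "finite (to_nat -` {..<n} :: 'i set)" by (intro finite_vimageI) auto
  qed
  have eq: "(\<Union>n. ?W n) = (\<Union>i\<in>I. V i)" by (auto intro: exI[of _ "Suc (to_nat _)"])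
  have W: "?W n \<in> sets coin_measure" for n
    using assms(1) fin by (intro sets.finite_UN) auto
  have "(\<lambda>n. measure coin_measure (?W n)) \<longlonglongrightarrow> measure coin_measure (\<Union>n. ?W n)"
  proof (rule coin.finite_Lim_measure_incseq)
    show "range ?W \<subseteq> sets coin_measure" using W by blast
    show "incseq ?W" unfolding incseq_def by (auto intro: less_le_trans)
  qed
  moreover have "measure coin_measure (?W n) \<le> c" for n
  proof -
    have "measure coin_measure (?W n) \<le> (\<Sum>i\<in>?F n. measure coin_measure (V i))"
      using assms(1) by (intro coin.finite_measure_subadditive_finite[OF fin]) auto
    also have "\<dots> \<le> c" by (intro le fin) auto
    finally show ?thesis .
  qed
  ultimately show ?thesis unfolding eq by (intro LIMSEQ_le_const2) auto
qed

section \<open>Effectively open classes\<close>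

definition Sigma1_class :: "cantor \<Rightarrow> cantor set \<Rightarrow> bool" where
  "Sigma1_class B S \<longleftrightarrow>
    (\<exists>e. S = {X. \<exists>\<sigma>. run B e (str_code \<sigma>) \<noteq> None \<and> initial_segment \<sigma> X})"

lemma Sigma1_classI:
  assumes "decidable (\<lambda>A z. P A (pfst z) (psnd z))"
    and "\<And>X. X \<in> S \<longleftrightarrow> (\<exists>\<sigma>. (\<exists>r. P B (str_code \<sigma>) r) \<and> initial_segment \<sigma> X)"
  shows "Sigma1_class B S"
proof -
  obtain e where "\<forall>A x. run A e x \<noteq> None \<longleftrightarrow> (\<exists>r. P A x r)"
    using computable_mu[OF assms(1)] by blast
  then have "S = {X. \<exists>\<sigma>. run B e (str_code \<sigma>) \<noteq> None \<and> initial_segment \<sigma> X}"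
    using assms(2) by (intro set_eqI) simp
  then show ?thesis unfolding Sigma1_class_def by blast
qed

lemma Sigma1_class_sets:
  assumes "Sigma1_class B S"
  shows "S \<in> sets coin_measure"
proof -
  obtain e where e: "S = {X. \<exists>\<sigma>. run B e (str_code \<sigma>) \<noteq> None \<and> initial_segment \<sigma> X}"
    using assms unfolding Sigma1_class_def by blast
  have "S = (\<Union>\<sigma>\<in>{\<sigma>. run B e (str_code \<sigma>) \<noteq> None}. {X. initial_segment \<sigma> X})"
    unfolding e by blast
  also have "\<dots> \<in> sets coin_measure"
    by (intro sets.countable_UN'') auto
  finally show ?thesis .
qed

lemma Sigma1_class_open:
  assumes "Sigma1_class B S" "X \<in> S"
  obtains n where "\<And>Y. (\<And>j. j < n \<Longrightarrow> Y j = X j) \<Longrightarrow> Y \<in> S"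
proof -
  obtain e where e: "S = {X. \<exists>\<sigma>. run B e (str_code \<sigma>) \<noteq> None \<and> initial_segment \<sigma> X}"
    using assms unfolding Sigma1_class_def by blast
  obtain \<sigma> where \<sigma>: "run B e (str_code \<sigma>) \<noteq> None" "initial_segment \<sigma> X"
    using assms(2) unfolding e by blast
  have "Y \<in> S" if "\<And>j. j < length \<sigma> \<Longrightarrow> Y j = X j" for Y
  proof -
    have "initial_segment \<sigma> Y"
      using \<sigma>(2) that unfolding initial_segment_iff by simp
    then show ?thesis using \<sigma>(1) unfolding e by blast
  qed
  then show ?thesis using that by blast
qed

lemma Sigma1_class_empty: "Sigma1_class B {}"
proof (rule Sigma1_classI)
  show "decidable (\<lambda>A z. 1 \<le> (0 :: nat))" by (intro comp_intros)
qed simp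

text \<open>The two enumerations run in parallel: the sum of their stage values is positive as soon
  as one of them has halted.\<close>

lemma Sigma1_class_Un:
  assumes "Sigma1_class B S" "Sigma1_class B T"
  shows "Sigma1_class B (S \<union> T)"
proof -
  obtain a b where ab: "S = {X. \<exists>\<sigma>. run B a (str_code \<sigma>) \<noteq> None \<and> initial_segment \<sigma> X}"
    "T = {X. \<exists>\<sigma>. run B b (str_code \<sigma>) \<noteq> None \<and> initial_segment \<sigma> X}"
    using assms unfolding Sigma1_class_def by blast
  obtain f g where f: "approximates f a" and g: "approximates g b"
    using approximation_exists by blast
  show ?thesis
  proof (rule Sigma1_classI)
    show "decidable (\<lambda>A z. 0 < f A (prod_encode (pfst z, psnd z)) + g A (prod_encode (pfst z, psnd z)))"
      by (intro comp_intros computable_comp[OF approximatesD(1)[OF f]]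
          computable_comp[OF approximatesD(1)[OF g]])
    show "X \<in> S \<union> T \<longleftrightarrow> (\<exists>\<sigma>. (\<exists>r. 0 < f B (prod_encode (str_code \<sigma>, r)) + g B (prod_encode (str_code \<sigma>, r)))
        \<and> initial_segment \<sigma> X)" for X
      unfolding ab approximates_halts[OF f] approximates_halts[OF g] add_gr_0 Un_iff mem_Collect_eq
      by blast
  qed
qed

text \<open>All strings longer than \<open>j\<close> with the right bit at \<open>j\<close> are
  enumerated; the witness \<open>r\<close> guesses the string as value and length.\<close>

lemma Sigma1_class_coord: "Sigma1_class B {X. X j = b}"
proof (rule Sigma1_classI)
  let ?P = "\<lambda>A x r. x = str_code (bits (pfst r) (psnd r)) \<and> j < psnd r \<and>
    of_bool (odd (pfst r div 2 ^ (psnd r - Suc j))) = (of_bool b :: nat)"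
  show "decidable (\<lambda>A z. ?P A (pfst z) (psnd z))"
    by (intro comp_intros)
  show "X \<in> {X. X j = b} \<longleftrightarrow> (\<exists>\<sigma>. (\<exists>r. ?P B (str_code \<sigma>) r) \<and> initial_segment \<sigma> X)" for X
  proof
    assume X: "X \<in> {X. X j = b}"
    let ?\<sigma> = "map X [0..<Suc j]"
    obtain v where v: "bits v (Suc j) = ?\<sigma>" using bits_surj[of ?\<sigma>] by auto
    have "odd (v div 2 ^ (Suc j - Suc j)) = b"
      using X nth_bits[of j "Suc j" v] unfolding v by (simp del: upt_Suc)
    then have "?P B (str_code ?\<sigma>) (prod_encode (v, Suc j))"
      using v by simp
    moreover have "initial_segment ?\<sigma> X" by (simp add: initial_segment_def)
    ultimately show "\<exists>\<sigma>. (\<exists>r. ?P B (str_code \<sigma>) r) \<and> initial_segment \<sigma> X" by blast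
  next
    assume "\<exists>\<sigma>. (\<exists>r. ?P B (str_code \<sigma>) r) \<and> initial_segment \<sigma> X"
    then obtain \<sigma> r where r: "?P B (str_code \<sigma>) r" "initial_segment \<sigma> X" by blast
    then have "\<sigma> = bits (pfst r) (psnd r)" "j < psnd r" by (auto simp: str_code_inj)
    then have "X j = odd (pfst r div 2 ^ (psnd r - Suc j))"
      using r(2) unfolding initial_segment_iff by (simp add: nth_bits)
    then show "X \<in> {X. X j = b}" using r(1) by (simp add: of_bool_eq_iff)
  qed
qed

lemma Sigma1_class_nonvanishing: "finite D \<Longrightarrow> Sigma1_class B {X. \<exists>j\<in>D. X j}"
proof (induction D rule: finite_induct)
  case (insert j D)
  have eq: "{X. \<exists>j\<in>insert j D. X j} = {X. X j = True} \<union> {X. \<exists>j\<in>D. X j}" by auto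
  show ?case unfolding eq by (intro Sigma1_class_Un Sigma1_class_coord insert.IH)
qed (simp add: Sigma1_class_empty)

section \<open>Random sets by forcing\<close>

instance prog :: countable
  by countable_datatype

definition enumerated_classes :: "cantor \<Rightarrow> prog \<Rightarrow> nat \<Rightarrow> cantor set" where
  "enumerated_classes A e n =
    {X. \<exists>\<sigma>. run A e (prod_encode (n, str_code \<sigma>)) \<noteq> None \<and> initial_segment \<sigma> X}"

lemma uniformly_Sigma1_iff: "uniformly_Sigma1 A U \<longleftrightarrow> (\<exists>e. U = enumerated_classes A e)"
  unfolding uniformly_Sigma1_def enumerated_classes_def fun_eq_iff by simp

lemma Sigma1_class_enumerated: "Sigma1_class B (enumerated_classes B e n)"
proof -
  obtain c where "\<And>A x. run A c x = Some n"
    using computable_const unfolding computable_def by blast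
  then have "run A (Comp e (Pair c (Pair Fst Snd))) x = run A e (prod_encode (n, x))" for A x
    by simp
  then show ?thesis
    unfolding Sigma1_class_def enumerated_classes_def
    by (intro exI[of _ "Comp e (Pair c (Pair Fst Snd))"]) (simp only:)
qed

text \<open>
  A random set is built by forcing with effectively open classes \<open>S\<close> of measure below \<open>1\<close>, the
  condition \<open>S\<close> being the promise to stay outside \<open>S\<close>. Since every level of every test may be added
  to the conditions, no universal test is needed.
\<close>

theorem random_meeting_blocks:
  fixes \<D> :: "nat \<Rightarrow> nat set set"
  assumes fin: "\<And>k D. D \<in> \<D> k \<Longrightarrow> finite D"
    and meets: "\<And>k S. Sigma1_class B S \<Longrightarrow> measure coin_measure S < 1 \<Longrightarrow>
      \<exists>D\<in>\<D> k. 0 < measure coin_measure ({X. \<forall>j\<in>D. \<not> X j} - S)"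
  shows "\<exists>X. martin_loef_random B X \<and> (\<forall>k. \<exists>D\<in>\<D> k. \<forall>j\<in>D. \<not> X j)"
proof -
  define C where "C k S \<longleftrightarrow> Sigma1_class B S \<and> measure coin_measure S < 1" for k :: nat and S
  \<comment> \<open>The set under construction avoids all of \<open>S'\<close>: avoiding
    \<open>{X. X k = b}\<close> fixes its coordinate \<open>k\<close>, and avoiding the next class
    makes it vanish on \<open>D\<close>. As programs are countable, \<open>from_nat k\<close> runs
    through all tests.\<close>
  define Q where "Q k S S' \<longleftrightarrow> S \<subseteq> S' \<and> (\<exists>b. {X. X k = b} \<subseteq> S') \<and> (\<exists>D\<in>\<D> k. {X. \<exists>j\<in>D. X j} \<subseteq> S') \<and>
      (martin_loef_test B (enumerated_classes B (from_nat k)) \<longrightarrow>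
        (\<exists>m. enumerated_classes B (from_nat k) m \<subseteq> S'))" for k S S'
  have step: "\<exists>S'. C (Suc k) S' \<and> Q k S S'" if S: "C k S" for k S
  proof -
    have S1: "Sigma1_class B S" and lt: "measure coin_measure S < 1" using S by (auto simp: C_def)
    obtain D where D: "D \<in> \<D> k" "0 < measure coin_measure ({X. \<forall>j\<in>D. \<not> X j} - S)"
      using meets[OF S1 lt] by blast
    define T where "T = S \<union> {X. \<exists>j\<in>D. X j}"
    have T: "Sigma1_class B T"
      unfolding T_def using S1 fin[OF D(1)] by (intro Sigma1_class_Un Sigma1_class_nonvanishing)
    have "{X. \<forall>j\<in>D. \<not> X j} - S = space coin_measure - T" by (auto simp: T_def)
    then have Tlt: "measure coin_measure T < 1"
      using D(2) coin.prob_compl[OF Sigma1_class_sets[OF T]] by simp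
    define V where "V b = T \<union> {X. X k = b}" for b
    have V: "Sigma1_class B (V b)" for b
      unfolding V_def by (intro Sigma1_class_Un T Sigma1_class_coord)
    \<comment> \<open>Otherwise the complement of \<open>T\<close>, which has positive measure,
      would be the union of two null sets.\<close>
    have "\<exists>b. measure coin_measure (V b) < 1"
    proof (rule ccontr)
      assume "\<not> ?thesis"
      then have 1: "1 \<le> measure coin_measure (V b)" for b by (simp add: not_less)
      have "1 - measure coin_measure T = measure coin_measure (space coin_measure - T)"
        using coin.prob_compl[OF Sigma1_class_sets[OF T]] by simp
      also have "space coin_measure - T = (space coin_measure - V True) \<union> (space coin_measure - V False)"
        by (auto simp: V_def)
      also have "measure coin_measure \<dots> \<le> measure coin_measure (space coin_measure - V True)
          + measure coin_measure (space coin_measure - V False)"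
        by (intro measure_Un_le sets.compl_sets Sigma1_class_sets[OF V])
      also have "\<dots> \<le> 0"
        using 1[of True] 1[of False] coin.prob_compl[OF Sigma1_class_sets[OF V]] by simp
      finally show False using Tlt by simp
    qed
    then obtain b where b: "measure coin_measure (V b) < 1" by blast
    have "\<exists>S'. Sigma1_class B S' \<and> measure coin_measure S' < 1 \<and> V b \<subseteq> S' \<and>
      (martin_loef_test B (enumerated_classes B (from_nat k)) \<longrightarrow>
        (\<exists>m. enumerated_classes B (from_nat k) m \<subseteq> S'))"
    proof (cases "martin_loef_test B (enumerated_classes B (from_nat k))")
      case True
      define E where "E = enumerated_classes B (from_nat k)"
      have le: "measure coin_measure (E m) \<le> (1/2) ^ m" for m
        using True by (simp add: martin_loef_test_def E_def)
      \<comment> \<open>A level of the test small enough to fit into the measure still left.\<close>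
      obtain m :: nat where m: "(1/2) ^ m < 1 - measure coin_measure (V b)"
        using real_arch_pow_inv[of "1 - measure coin_measure (V b)" "1/2"] b by auto
      have E: "Sigma1_class B (E m)" unfolding E_def by (rule Sigma1_class_enumerated)
      have "measure coin_measure (V b \<union> E m) \<le> measure coin_measure (V b) + measure coin_measure (E m)"
        by (intro measure_Un_le Sigma1_class_sets[OF V] Sigma1_class_sets[OF E])
      then have "measure coin_measure (V b \<union> E m) < 1" using m le[of m] by simp
      moreover have "Sigma1_class B (V b \<union> E m)" using V E by (rule Sigma1_class_Un)
      ultimately show ?thesis unfolding E_def[symmetric] by blast
    next
      case False
      then show ?thesis using V b by blast
    qed
    then obtain S' where S': "Sigma1_class B S'" "measure coin_measure S' < 1" "V b \<subseteq> S'"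
      "martin_loef_test B (enumerated_classes B (from_nat k)) \<longrightarrow>
        (\<exists>m. enumerated_classes B (from_nat k) m \<subseteq> S')" by blast
    have "Q k S S'"
      using S'(3,4) D(1) unfolding Q_def V_def T_def by blast
    then show ?thesis using S'(1,2) unfolding C_def by blast
  qed
  have "\<exists>S. \<forall>k. C k (S k) \<and> Q k (S k) (S (Suc k))"
  proof (rule dependent_nat_choice)
    show "\<exists>S. C 0 S" by (intro exI[of _ "{}"]) (simp add: C_def Sigma1_class_empty)
  qed (rule step)
  then obtain S where S: "\<And>k. C k (S k)" and Q: "\<And>k. Q k (S k) (S (Suc k))" by blast
  have mono: "S k \<subseteq> S l" if "k \<le> l" for k l
  proof (rule lift_Suc_mono_le[of S, OF _ that])
    show "S n \<subseteq> S (Suc n)" for n using Q[of n] by (simp add: Q_def)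
  qed
  have "\<exists>Y. Y \<notin> S k" for k
  proof (rule ccontr)
    assume "\<not> ?thesis"
    then have "S k = space coin_measure" by auto
    then show False using S[of k] coin.prob_space by (simp add: C_def)
  qed
  then obtain Y where Y: "\<And>k. Y k \<notin> S k" by metis
  \<comment> \<open>All points outside \<open>S (Suc k)\<close> agree at coordinate
    \<open>k\<close>, since one of the two values has been put into the class. These common values
    define \<open>X\<close>.\<close>
  have "\<exists>c. \<forall>Z. Z \<notin> S (Suc k) \<longrightarrow> Z k = c" for k
  proof -
    obtain b where b: "{X. X k = b} \<subseteq> S (Suc k)" using Q[of k] unfolding Q_def by blast
    then have "\<forall>Z. Z \<notin> S (Suc k) \<longrightarrow> Z k = (\<not> b)" by auto
    then show ?thesis by blast
  qed
  then obtain X where X: "\<And>k Z. Z \<notin> S (Suc k) \<Longrightarrow> Z k = X k" by metis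
  have agree: "Y m j = X j" if "j < m" for m j
    using X[of "Y m" j] Y[of m] mono[of "Suc j" m] that by auto
  \<comment> \<open>\<open>X\<close> is the limit of the points \<open>Y m\<close>, and from
    \<open>m = k\<close> on these lie in the closed complement of \<open>S k\<close>.\<close>
  have outside: "X \<notin> S k" for k
  proof
    assume "X \<in> S k"
    then obtain n where n: "\<And>Z. (\<And>j. j < n \<Longrightarrow> Z j = X j) \<Longrightarrow> Z \<in> S k"
      using Sigma1_class_open S unfolding C_def by blast
    have "Y (max n k) \<in> S k" using agree by (intro n) simp
    then show False using Y[of "max n k"] mono[of k "max n k"] by auto
  qed
  have "martin_loef_random B X"
    unfolding martin_loef_random_def
  proof (intro allI impI)
    fix U assume U: "martin_loef_test B U"
    then obtain e where e: "U = enumerated_classes B e"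
      unfolding martin_loef_test_def uniformly_Sigma1_iff by blast
    obtain m where "U m \<subseteq> S (Suc (to_nat e))"
      using Q[of "to_nat e"] U unfolding Q_def e by auto
    then show "X \<notin> (\<Inter>n. U n)" using outside by blast
  qed
  moreover have "\<exists>D\<in>\<D> k. \<forall>j\<in>D. \<not> X j" for k
  proof -
    obtain D where D: "D \<in> \<D> k" "{X. \<exists>j\<in>D. X j} \<subseteq> S (Suc k)"
      using Q[of k] unfolding Q_def by blast
    then have "X \<notin> {X. \<exists>j\<in>D. X j}" using outside[of "Suc k"] by blast
    then show ?thesis using D(1) by auto
  qed
  ultimately show ?thesis by blast
qed

section \<open>Blocks that an effectively open class nearly covers\<close>

text \<open>
  A pair \<open>i = (n, u)\<close>, standing for the request for a code of length \<open>n\<close> of the string coded by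
  \<open>u\<close>, owns for every \<open>k\<close> a block of \<open>n + k + 1\<close> coordinates.
\<close>

definition block :: "nat \<Rightarrow> nat \<Rightarrow> nat set" where
  "block k i = (\<lambda>j. prod_encode (prod_encode (i, k), j)) ` {..<pfst i + k + 1}"

lemma finite_block [simp]: "finite (block k i)"
  by (simp add: block_def)

lemma ball_block:
  "(\<forall>q\<in>block k i. P q) \<longleftrightarrow> (\<forall>j<pfst i + k + 1. P (prod_encode (prod_encode (i, k), j)))"
  by (auto simp: block_def)

lemma card_block: "card (block k i) = pfst i + k + 1"
  unfolding block_def by (subst card_image) (auto simp: inj_on_def)

lemma disjoint_block: "disjoint_family_on (block k) F"
  by (auto simp: disjoint_family_on_def block_def)

lemma measure_block: "measure coin_measure {X. \<forall>j\<in>block k i. \<not> X j} = (1/2) ^ (pfst i + k + 1)"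
  using measure_coords[OF finite_block, of k i "\<lambda>_. False"] by (simp add: card_block)

lemma block_sets [simp]: "{X. \<forall>j\<in>block k i. \<not> X j} \<in> sets coin_measure"
proof -
  have "{X. \<forall>j\<in>block k i. \<not> X j} = (\<Inter>j. {X. j \<in> block k i \<longrightarrow> X j = False})" by auto
  also have "\<dots> \<in> sets coin_measure"
    by (intro sets.countable_INT' Collect_sets_coin pred_intros_imp' coord_eq_measurable image_subsetI) auto
  finally show ?thesis .
qed

text \<open>
  \<open>uncovered g k A i L v\<close>: the string of length \<open>L\<close> with value \<open>v\<close> is compatible with the block of
  \<open>i\<close> being constantly \<open>0\<close>, and by stage \<open>L\<close> none of its prefixes has been enumerated by \<open>g\<close>.
\<close>

definition uncovered :: "(cantor \<Rightarrow> nat \<Rightarrow> nat) \<Rightarrow> nat \<Rightarrow> cantor \<Rightarrow> nat \<Rightarrow> nat \<Rightarrow> nat \<Rightarrow> bool" where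
  "uncovered g k A i L v \<longleftrightarrow>
    (\<forall>j<pfst i + k + 1. prod_encode (prod_encode (i, k), j) < L \<longrightarrow>
      even (v div 2 ^ (L - Suc (prod_encode (prod_encode (i, k), j))))) \<and>
    (\<forall>p<Suc L. g A (prod_encode (str_code (bits (v div 2 ^ (L - p)) p), L)) = 0)"

text \<open>The uncovered strings have measure below \<open>2 ^ -(i + c)\<close>, cleared of
  denominators to give a decidable inequality. The threshold shrinks with the index \<open>i\<close>
  itself, so that the errors over all indices are summable, with sum at most
  \<open>2 ^ (1 - c)\<close>.\<close>

definition nearly_covered :: "(cantor \<Rightarrow> nat \<Rightarrow> nat) \<Rightarrow> nat \<Rightarrow> nat \<Rightarrow> cantor \<Rightarrow> nat \<Rightarrow> nat \<Rightarrow> bool" where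
  "nearly_covered g k c A i L \<longleftrightarrow>
    (\<Sum>v<2 ^ L. of_bool (uncovered g k A i L v)) * 2 ^ (i + c) < (2 ^ L :: nat)"

lemma decidable_nearly_covered:
  assumes "computable g"
  shows "decidable (\<lambda>A z. nearly_covered g k c A (pfst z) (psnd z))"
  unfolding nearly_covered_def uncovered_def
  by (intro comp_intros computable_comp[OF assms])

locale approximated_class =
  fixes B :: cantor and S :: "cantor set" and e :: prog and g :: "cantor \<Rightarrow> nat \<Rightarrow> nat"
  assumes S_eq: "S = {X. \<exists>\<sigma>. run B e (str_code \<sigma>) \<noteq> None \<and> initial_segment \<sigma> X}"
    and approx: "approximates g e"
begin

text \<open>A clopen outer approximation, depending on the first \<open>L\<close> coordinates only,
  to the part of the block event that \<open>S\<close> misses. \<open>surviving\<close> is the same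
  condition on strings.\<close>

definition stage :: "nat \<Rightarrow> nat \<Rightarrow> nat \<Rightarrow> cantor set" where
  "stage k i L = {X. (\<forall>q\<in>block k i. q < L \<longrightarrow> \<not> X q) \<and>
    (\<forall>p\<le>L. g B (prod_encode (str_code (map X [0..<p]), L)) = 0)}"

definition surviving :: "nat \<Rightarrow> nat \<Rightarrow> bool list \<Rightarrow> bool" where
  "surviving k i \<sigma> \<longleftrightarrow> (\<forall>q\<in>block k i. q < length \<sigma> \<longrightarrow> \<not> \<sigma> ! q) \<and>
    (\<forall>p\<le>length \<sigma>. g B (prod_encode (str_code (take p \<sigma>), length \<sigma>)) = 0)"

lemma stage_eq: "stage k i L = {X. surviving k i (map X [0..<L])}"
  by (simp add: stage_def surviving_def take_map cong: conj_cong)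

lemma surviving_bits: "surviving k i (bits v L) \<longleftrightarrow> uncovered g k B i L v"
  unfolding surviving_def uncovered_def ball_block
  by (simp add: nth_bits take_bits less_Suc_eq_le cong: conj_cong imp_cong)

lemma stage_sets: "stage k i L \<in> sets coin_measure"
  unfolding stage_eq by (rule prefix_predicate_sets)

lemma measure_stage:
  "measure coin_measure (stage k i L) = real (\<Sum>v<2 ^ L. of_bool (uncovered g k B i L v)) / 2 ^ L"
proof -
  have "(\<Sum>v<2 ^ L. of_bool (uncovered g k B i L v)) = card {v. v < 2 ^ L \<and> uncovered g k B i L v}"
    by (simp add: lessThan_def Collect_conj_eq)
  then show ?thesis
    unfolding stage_eq measure_prefix_predicate surviving_bits by simp
qed

lemma nearly_covered_iff:
  "nearly_covered g k c B i L \<longleftrightarrow> measure coin_measure (stage k i L) < (1/2) ^ (i + c)"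
proof -
  have "nearly_covered g k c B i L \<longleftrightarrow>
      real ((\<Sum>v<2 ^ L. of_bool (uncovered g k B i L v)) * 2 ^ (i + c)) < real (2 ^ L)"
    unfolding nearly_covered_def of_nat_less_iff ..
  also have "\<dots> \<longleftrightarrow> measure coin_measure (stage k i L) < (1/2) ^ (i + c)"
    unfolding measure_stage by (simp add: field_simps power_one_over)
  finally show ?thesis .
qed

lemma stage_Inter: "(\<Inter>L. stage k i L) = {X. \<forall>j\<in>block k i. \<not> X j} - S"
proof (intro equalityI subsetI)
  fix X assume X: "X \<in> (\<Inter>L. stage k i L)"
  have "\<not> X q" if "q \<in> block k i" for q
    using X that unfolding stage_def by (auto dest!: spec[of _ "Suc q"])
  moreover have "X \<notin> S"
  proof
    assume "X \<in> S"
    then obtain \<sigma> where "run B e (str_code \<sigma>) \<noteq> None" and \<sigma>: "initial_segment \<sigma> X"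
      unfolding S_eq by blast
    then obtain s where "0 < g B (prod_encode (str_code \<sigma>, s))"
      unfolding approximates_halts[OF approx] by blast
    \<comment> \<open>The stage must also reach the length of \<sigma>, since stage \<open>L\<close>
      inspects only prefixes of length up to \<open>L\<close>.\<close>
    then have "0 < g B (prod_encode (str_code \<sigma>, max s (length \<sigma>)))"
      using approximates_halts_mono[OF approx] by simp
    moreover have "X \<in> stage k i (max s (length \<sigma>))" using X by blast
    then have "g B (prod_encode (str_code (map X [0..<length \<sigma>]), max s (length \<sigma>))) = 0"
      unfolding stage_def by simp
    ultimately show False
      using \<sigma> unfolding initial_segment_def by simp
  qed
  ultimately show "X \<in> {X. \<forall>j\<in>block k i. \<not> X j} - S" by blast
next
  fix X assume X: "X \<in> {X. \<forall>j\<in>block k i. \<not> X j} - S"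
  have "g B (prod_encode (str_code (map X [0..<p]), L)) = 0" for p L
  proof (rule ccontr)
    assume "g B (prod_encode (str_code (map X [0..<p]), L)) \<noteq> 0"
    then have "run B e (str_code (map X [0..<p])) \<noteq> None"
      unfolding approximates_halts[OF approx] by (metis gr0I)
    moreover have "initial_segment (map X [0..<p]) X" by (simp add: initial_segment_def)
    ultimately show False using X unfolding S_eq by blast
  qed
  then show "X \<in> (\<Inter>L. stage k i L)" using X unfolding stage_def by simp
qed

lemma S_sets: "S \<in> sets coin_measure"
  by (rule Sigma1_class_sets[of B]) (unfold Sigma1_class_def, rule exI, rule S_eq)

lemma measure_of_nearly_covered:
  assumes "nearly_covered g k c B i L"
  shows "measure coin_measure ({X. \<forall>j\<in>block k i. \<not> X j} - S) \<le> (1/2) ^ (i + c)"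
proof -
  have "measure coin_measure ({X. \<forall>j\<in>block k i. \<not> X j} - S) \<le> measure coin_measure (stage k i L)"
    unfolding stage_Inter[symmetric] by (intro coin.finite_measure_mono stage_sets) auto
  then show ?thesis using assms unfolding nearly_covered_iff by simp
qed

text \<open>The stages decrease to a null set, so their measures fall below any threshold.\<close>

lemma nearly_covered_of_null:
  assumes "measure coin_measure ({X. \<forall>j\<in>block k i. \<not> X j} - S) = 0"
  shows "\<exists>L. nearly_covered g k c B i L"
proof -
  have "decseq (stage k i)"
  proof (unfold decseq_def, intro allI impI subsetI)
    fix L M X assume "L \<le> M" and X: "X \<in> stage k i M"
    have "g B (prod_encode (str_code (map X [0..<p]), L)) = 0" if "p \<le> L" for p
    proof (rule ccontr)
      assume "g B (prod_encode (str_code (map X [0..<p]), L)) \<noteq> 0"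
      then have "0 < g B (prod_encode (str_code (map X [0..<p]), M))"
        using approximates_halts_mono[OF approx _ \<open>L \<le> M\<close>] by simp
      then show False using X that \<open>L \<le> M\<close> unfolding stage_def by force
    qed
    then show "X \<in> stage k i L" using X \<open>L \<le> M\<close> unfolding stage_def by simp
  qed
  then have "(\<lambda>L. measure coin_measure (stage k i L)) \<longlonglongrightarrow> measure coin_measure (\<Inter>L. stage k i L)"
    by (intro coin.finite_Lim_measure_decseq) (use stage_sets in blast)
  then have "(\<lambda>L. measure coin_measure (stage k i L)) \<longlonglongrightarrow> 0"
    unfolding stage_Inter assms .
  then have "\<forall>\<^sub>F L in sequentially. measure coin_measure (stage k i L) < (1/2) ^ (i + c)"
    by (rule order_tendstoD) simp
  then show ?thesis
    unfolding nearly_covered_iff using eventually_happens trivial_limit_sequentially by blast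
qed

text \<open>With \<delta> the measure outside \<open>S\<close>, the choice of \<open>c\<close> keeps
  the total error at most \<delta>/2, so all block events of \<open>F\<close> fail together with
  probability at least \<delta>/2. By independence and \<open>1 - x \<le> exp (- x)\<close>, this
  probability is at most \<open>exp (- w / 2 ^ (k + 1))\<close> for the weight \<open>w\<close> of
  \<open>F\<close>. Hence \<open>w\<close> is at most
  \<open>2 ^ (k + 1) * ln (2 / \<delta>)\<close>, a bound independent of \<open>F\<close>.\<close>

lemma nearly_covered_weight:
  assumes "measure coin_measure S < 1"
  shows "\<exists>c d. \<forall>F. finite F \<longrightarrow> F \<subseteq> {i. \<exists>L. nearly_covered g k c B i L} \<longrightarrow>
    (\<Sum>i\<in>F. (1/2) ^ pfst i) \<le> (2::real) ^ d"
proof -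
  define \<delta> where "\<delta> = 1 - measure coin_measure S"
  have "0 < \<delta>" using assms by (simp add: \<delta>_def)
  obtain c :: nat where c: "(1/2) ^ c < \<delta> / 4"
    using real_arch_pow_inv[of "\<delta> / 4" "1/2"] \<open>0 < \<delta>\<close> by auto
  obtain d where d: "2 ^ (k + 1) * ln (2 / \<delta>) < (2::real) ^ d"
    using real_arch_pow[of 2] by auto
  have "(\<Sum>i\<in>F. (1/2) ^ pfst i) \<le> (2::real) ^ d"
    if "finite F" and F: "F \<subseteq> {i. \<exists>L. nearly_covered g k c B i L}" for F
  proof -
    let ?V = "\<lambda>i. {X. \<forall>j\<in>block k i. \<not> X j}"
    let ?N = "{X. \<forall>i\<in>F. \<exists>j\<in>block k i. X j}"
    have N: "?N = space coin_measure - (\<Union>i\<in>F. ?V i)" by auto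
    have N_sets: "?N \<in> sets coin_measure"
      unfolding N using \<open>finite F\<close> by (intro sets.compl_sets sets.finite_UN) auto
    have VS: "?V i - S \<in> sets coin_measure" for i
      using S_sets by (intro sets.Diff) auto
    have "(\<Sum>i\<in>F. measure coin_measure (?V i - S)) \<le> (\<Sum>i\<in>F. (1/2) ^ (i + c))"
      using F measure_of_nearly_covered by (intro sum_mono) blast
    also have "\<dots> = (1/2) ^ c * (\<Sum>i\<in>F. (1/2) ^ i)"
      by (simp add: power_add sum_distrib_left mult.commute)
    also have "(\<Sum>i\<in>F. (1/2) ^ i) \<le> (\<Sum>i. (1/2::real) ^ i)"
      using \<open>finite F\<close> by (intro sum_le_suminf summable_geometric) auto
    also have "(\<Sum>i. (1/2::real) ^ i) = 2" by (subst suminf_geometric) auto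
    finally have small: "(\<Sum>i\<in>F. measure coin_measure (?V i - S)) \<le> \<delta> / 2"
      using c by (simp add: mult_left_mono)
    \<comment> \<open>A point outside \<open>S\<close> either escapes every block event of
      \<open>F\<close> or lies in the uncovered part of one.\<close>
    have "\<delta> = measure coin_measure (space coin_measure - S)"
      using coin.prob_compl[OF S_sets] by (simp add: \<delta>_def)
    also have "\<dots> \<le> measure coin_measure (?N \<union> (\<Union>i\<in>F. ?V i - S))"
      using N_sets VS \<open>finite F\<close> by (intro coin.finite_measure_mono sets.Un sets.finite_UN) auto
    also have "\<dots> \<le> measure coin_measure ?N + measure coin_measure (\<Union>i\<in>F. ?V i - S)"
      using N_sets VS \<open>finite F\<close> by (intro measure_Un_le sets.finite_UN) auto
    also have "measure coin_measure (\<Union>i\<in>F. ?V i - S) \<le> (\<Sum>i\<in>F. measure coin_measure (?V i - S))"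
      using VS \<open>finite F\<close> by (intro coin.finite_measure_subadditive_finite) auto
    also have "\<dots> \<le> \<delta> / 2" by (rule small)
    finally have "\<delta> / 2 \<le> measure coin_measure ?N" by simp
    also have "\<dots> = (\<Prod>i\<in>F. 1 - (1/2) ^ (pfst i + k + 1))"
      using measure_avoid_blocks[OF \<open>finite F\<close> finite.emptyI finite_block disjoint_block, of k]
      by (simp add: card_block)
    also have "\<dots> \<le> (\<Prod>i\<in>F. exp (- ((1/2) ^ (pfst i + k + 1))))"
    proof (intro prod_mono conjI)
      fix i
      show "0 \<le> 1 - (1/2::real) ^ (pfst i + k + 1)"
        using power_le_one[of "1/2::real" "pfst i + k + 1"] by linarith
      show "1 - (1/2::real) ^ (pfst i + k + 1) \<le> exp (- ((1/2) ^ (pfst i + k + 1)))"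
        using exp_ge_add_one_self[of "- ((1/2::real) ^ (pfst i + k + 1))"] by linarith
    qed
    also have "\<dots> = exp (- (\<Sum>i\<in>F. (1/2) ^ (pfst i + k + 1)))"
      using \<open>finite F\<close> by (simp only: exp_sum[symmetric] sum_negf)
    finally have "ln (\<delta> / 2) \<le> ln (exp (- (\<Sum>i\<in>F. (1/2) ^ (pfst i + k + 1))))"
      using \<open>0 < \<delta>\<close> by (subst ln_le_cancel_iff) auto
    then have "ln (\<delta> / 2) \<le> - (\<Sum>i\<in>F. (1/2) ^ (pfst i + k + 1))"
      by (simp only: ln_exp)
    moreover have "(\<Sum>i\<in>F. (1/2::real) ^ (pfst i + k + 1)) = (1/2) ^ (k + 1) * (\<Sum>i\<in>F. (1/2) ^ pfst i)"
      by (simp add: power_add sum_distrib_left mult_ac)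
    moreover have "ln (2 / \<delta>) = - ln (\<delta> / 2)"
      using \<open>0 < \<delta>\<close> by (simp add: ln_div)
    ultimately have "(1/2) ^ (k + 1) * (\<Sum>i\<in>F. (1/2) ^ pfst i) \<le> ln (2 / \<delta>)" by linarith
    then have "(\<Sum>i\<in>F. (1/2) ^ pfst i) \<le> 2 ^ (k + 1) * ln (2 / \<delta>)"
      by (simp add: power_one_over field_simps)
    then show ?thesis using d by linarith
  qed
  then show ?thesis by blast
qed

end

section \<open>Shannon-Fano codes for enumerated requests\<close>

text \<open>
  Every index \<open>i = (n, u)\<close> with \<open>R A i L\<close> for some \<open>L\<close> requests a code of length \<open>n + d + 1\<close> for
  the string coded by \<open>u\<close>. The event \<open>r = (i, L)\<close> with the least such \<open>L\<close> is given the interval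
  \<open>[s, s + 2 ^ -(n + d))\<close>, where \<open>s\<close> is the total weight of the earlier events. Since \<open>n\<close> is at most
  \<open>r\<close>, \<open>event_offset\<close> is \<open>s\<close> in units of \<open>2 ^ -(r + n + d + 1)\<close>, and \<open>event_code\<close> is the index of a
  dyadic interval of half the length inside the given one.
\<close>

abbreviation event_len :: "nat \<Rightarrow> nat" where "event_len r \<equiv> pfst (pfst r)"

context
  fixes R :: "cantor \<Rightarrow> nat \<Rightarrow> nat \<Rightarrow> bool" and d :: nat
  assumes decidable_R: "decidable (\<lambda>A z. R A (pfst z) (psnd z))"
begin

definition event :: "cantor \<Rightarrow> nat \<Rightarrow> bool" where
  "event A r \<longleftrightarrow> R A (pfst r) (psnd r) \<and> (\<forall>L<psnd r. \<not> R A (pfst r) L)"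

definition event_offset :: "cantor \<Rightarrow> nat \<Rightarrow> nat" where
  "event_offset A r = (\<Sum>j<r. of_bool (event A j) * 2 ^ (r + event_len r + 1 - event_len j))"

definition event_code :: "cantor \<Rightarrow> nat \<Rightarrow> nat" where
  "event_code A r = event_offset A r div 2 ^ r + 1"

text \<open>For an arbitrary oracle the total weight may exceed \<open>1\<close>. The bound drops
  codes that leave the unit interval, which keeps the machine prefix-free for every oracle.\<close>

definition codes :: "cantor \<Rightarrow> nat \<Rightarrow> nat \<Rightarrow> bool" where
  "codes A x r \<longleftrightarrow> event A r \<and> event_code A r < 2 ^ (event_len r + d + 1) \<and>
    x = str_code (bits (event_code A r) (event_len r + d + 1))"

definition request_machine :: machine where
  "request_machine A \<sigma> = (if \<exists>r. codes A (str_code \<sigma>) r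
    then let u = psnd (pfst (LEAST r. codes A (str_code \<sigma>) r)) in Some (bits (pfst u) (psnd u))
    else None)"

definition total_weight :: "cantor \<Rightarrow> nat \<Rightarrow> real" where
  "total_weight A r = (\<Sum>j<r. of_bool (event A j) * (1/2) ^ (event_len j + d))"

lemma decidable_event: "computable f \<Longrightarrow> decidable (\<lambda>A x. event A (f A x))"
proof -
  have *: "decidable (\<lambda>A x. R A (f A x) (h A x))" if "computable f" "computable h" for f h
    using computable_comp2[of "\<lambda>A a b. of_bool (R A a b)"] decidable_R that
    by (simp add: decidable_def)
  have "decidable (\<lambda>A r. event A r)"
    unfolding event_def by (intro comp_intros *)
  then show "decidable (\<lambda>A x. event A (f A x))" if "computable f"
    using computable_comp[OF _ that] by (simp add: decidable_def)
qed

lemma computable_event_code: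
  assumes "computable f"
  shows "computable (\<lambda>A x. event_code A (f A x))"
proof -
  have "computable (\<lambda>A r. event_code A r)"
    unfolding event_code_def event_offset_def by (intro comp_intros decidable_event)
  then show ?thesis using assms by (rule computable_comp)
qed

lemma computable_request_machine: "computable_machine request_machine"
proof -
  have "decidable (\<lambda>A z. codes A (pfst z) (psnd z))"
    unfolding codes_def by (intro comp_intros decidable_event computable_event_code)
  moreover have "computable (\<lambda>A z. str_code (bits (pfst (psnd (pfst (psnd z)))) (psnd (psnd (pfst (psnd z))))))"
    by (intro comp_intros)
  ultimately obtain e where "\<forall>A x. run A e x = (if \<exists>r. codes A x r
      then Some (str_code (bits (pfst (psnd (pfst (LEAST r. codes A x r)))) (psnd (psnd (pfst (LEAST r. codes A x r))))))
      else None)"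
    using computable_search[of codes "\<lambda>A x r. str_code (bits (pfst (psnd (pfst r))) (psnd (psnd (pfst r))))"]
    by blast
  then show ?thesis
    unfolding computable_machine_def request_machine_def
    by (intro exI[of _ e]) (simp add: Let_def)
qed

lemma event_len_le: "event_len r \<le> r"
proof -
  have "pfst n \<le> n" for n
    using le_prod_encode_1[of "pfst n" "psnd n"] by simp
  then show ?thesis using order_trans by blast
qed

lemma event_offset_eq:
  "real (event_offset A r) = 2 ^ (r + event_len r + d + 1) * total_weight A r"
proof -
  have "real (2 ^ (r + event_len r + 1 - event_len j)) = 2 ^ (r + event_len r + d + 1) * (1/2) ^ (event_len j + d)"
    if "j < r" for j
  proof -
    \<comment> \<open>Since \<open>event_len j \<le> j < r\<close>, the truncated subtraction in
      \<open>event_offset\<close> is exact.\<close>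
    have eq: "r + event_len r + d + 1 = (r + event_len r + 1 - event_len j) + (event_len j + d)"
      using event_len_le[of j] that by simp
    have "(2::real) ^ (a + b) * (1/2) ^ b = 2 ^ a" for a b
      by (simp add: power_add power_one_over)
    then show ?thesis unfolding eq by simp
  qed
  then have "real (of_bool (event A j) * 2 ^ (r + event_len r + 1 - event_len j)) =
      2 ^ (r + event_len r + d + 1) * (of_bool (event A j) * (1/2) ^ (event_len j + d))" if "j < r" for j
    using that by simp
  then show ?thesis
    unfolding event_offset_def total_weight_def of_nat_sum sum_distrib_left
    by (intro sum.cong) auto
qed

text \<open>In units of \<open>2 ^ -(event_len r + d + 1)\<close> the allotted interval has length
  \<open>2\<close>. Its start, rounded down and increased by \<open>1\<close>, therefore begins a
  unit interval inside it.\<close>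

lemma event_interval:
  assumes "event A r"
  shows "total_weight A r * 2 ^ (event_len r + d + 1) \<le> real (event_code A r)"
    and "real (event_code A r) + 1 \<le> total_weight A (Suc r) * 2 ^ (event_len r + d + 1)"
proof -
  let ?t = "total_weight A r * 2 ^ (event_len r + d + 1)"
  have "real (event_offset A r) / 2 ^ r = ?t"
    by (simp add: event_offset_eq power_add)
  moreover have "real (event_offset A r div 2 ^ r) \<le> real (event_offset A r) / real (2 ^ r)"
    by (rule of_nat_div_le_of_nat)
  moreover have "real (event_offset A r) / real (2 ^ r) - real (event_offset A r div 2 ^ r) \<le> 1"
  proof -
    have "a / b - real_of_int \<lfloor>a / b\<rfloor> \<le> 1" for a b :: real by linarith
    then show ?thesis by (metis floor_divide_of_nat_eq of_int_of_nat_eq)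
  qed
  ultimately show "?t \<le> real (event_code A r)"
    and "real (event_code A r) + 1 \<le> total_weight A (Suc r) * 2 ^ (event_len r + d + 1)"
    using assms by (simp_all add: event_code_def total_weight_def distrib_right power_one_over)
qed

lemma total_weight_mono: "r \<le> r' \<Longrightarrow> total_weight A r \<le> total_weight A r'"
  unfolding total_weight_def by (intro sum_mono2) auto

text \<open>The value of a prefix is the quotient of the longer string's value by a power of
  \<open>2\<close>; being a prefix thus means nesting of dyadic intervals.\<close>

lemma prefix_code_bounds:
  assumes "prefix (bits v m) (bits w n)" "v < 2 ^ m" "w < 2 ^ n"
  shows "real v / 2 ^ m \<le> real w / 2 ^ n" "real w / 2 ^ n < (real v + 1) / 2 ^ m"
proof -
  have "m \<le> n" using prefix_length_le[OF assms(1)] by simp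
  have "bits v m = take m (bits w n)"
    using assms(1) by (auto simp: prefix_def intro: sym)
  then have "bits v m = bits (w div 2 ^ (n - m)) m" using take_bits[OF \<open>m \<le> n\<close>] by simp
  moreover have "w div 2 ^ (n - m) < 2 ^ m"
    using assms(3) \<open>m \<le> n\<close> by (simp add: less_mult_imp_div_less flip: power_add)
  ultimately have v: "v = w div 2 ^ (n - m)" using bits_inj assms(2) by blast
  have n: "(2::real) ^ n = 2 ^ (n - m) * 2 ^ m" using \<open>m \<le> n\<close> by (simp flip: power_add)
  have "v * 2 ^ (n - m) \<le> w" "w < (v + 1) * 2 ^ (n - m)"
    unfolding v by (simp_all add: dividend_less_div_times div_times_less_eq_dividend)
  then have "real (v * 2 ^ (n - m)) \<le> real w" "real w < real ((v + 1) * 2 ^ (n - m))"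
    unfolding of_nat_le_iff of_nat_less_iff by blast+
  then show "real v / 2 ^ m \<le> real w / 2 ^ n" "real w / 2 ^ n < (real v + 1) / 2 ^ m"
    unfolding n by (simp_all add: field_simps)
qed

text \<open>Distinct events own disjoint intervals, ordered by index, whereas comparable strings
  have nested ones. The case \<sigma> = \<tau> shows that a code word determines its event.\<close>

lemma codes_prefix_eq:
  assumes r: "codes A (str_code \<sigma>) r" and r': "codes A (str_code \<tau>) r'" and "prefix \<sigma> \<tau>"
  shows "r = r'"
proof -
  let ?l = "event_len r + d + 1" and ?l' = "event_len r' + d + 1"
  have lower: "total_weight A r \<le> real (event_code A r) / 2 ^ (event_len r + d + 1)"
    and upper: "(real (event_code A r) + 1) / 2 ^ (event_len r + d + 1) \<le> total_weight A (Suc r)"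
    if "event A r" for r
    using event_interval[OF that] by (simp_all add: pos_le_divide_eq pos_divide_le_eq)
  have "\<sigma> = bits (event_code A r) ?l" "\<tau> = bits (event_code A r') ?l'"
    using r r' by (auto simp: codes_def str_code_inj)
  then have "prefix (bits (event_code A r) ?l) (bits (event_code A r') ?l')"
    using \<open>prefix \<sigma> \<tau>\<close> by simp
  note b = prefix_code_bounds[OF this]
  have code: "event_code A r < 2 ^ ?l" "event_code A r' < 2 ^ ?l'" and ev: "event A r" "event A r'"
    using r r' by (auto simp: codes_def)
  note b = b[OF code]
  have pos: "real (event_code A q) / 2 ^ l < (real (event_code A q) + 1) / 2 ^ l" for q l
    by (simp add: divide_strict_right_mono)
  have "\<not> r < r'"
  proof
    assume "r < r'"
    then have "total_weight A (Suc r) \<le> total_weight A r'" by (intro total_weight_mono) simp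
    then show False using upper[OF ev(1)] lower[OF ev(2)] b(2) by linarith
  qed
  moreover have "\<not> r' < r"
  proof
    assume "r' < r"
    then have "total_weight A (Suc r') \<le> total_weight A r" by (intro total_weight_mono) simp
    then show False
      using upper[OF ev(2)] lower[OF ev(1)] b(1) pos[of r' ?l'] by linarith
  qed
  ultimately show ?thesis by simp
qed

lemma prefix_free_request_machine: "prefix_free_machine request_machine"
  unfolding prefix_free_machine_def prefix_free_def
proof (intro conjI allI ballI impI)
  fix A \<sigma> \<tau>
  assume "\<sigma> \<in> dom (request_machine A)" "\<tau> \<in> dom (request_machine A)" and pre: "prefix \<sigma> \<tau>"
  then obtain r r' where r: "codes A (str_code \<sigma>) r" "codes A (str_code \<tau>) r'"
    by (auto simp: request_machine_def split: if_splits)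
  then have "r = r'" using pre by (rule codes_prefix_eq)
  then show "\<sigma> = \<tau>" using r by (simp add: codes_def str_code_inj[symmetric])
qed (rule computable_request_machine)

text \<open>The weight bound keeps the intervals for \<open>B\<close> inside the unit interval, so
  no request of \<open>B\<close> is dropped.\<close>

lemma request_machine_output:
  assumes weight: "\<And>F. finite F \<Longrightarrow> F \<subseteq> {i. \<exists>L. R B i L} \<Longrightarrow> (\<Sum>i\<in>F. (1/2) ^ pfst i) \<le> (2::real) ^ d"
    and "R B i L"
  shows "\<exists>\<sigma>. request_machine B \<sigma> = Some (bits (pfst (psnd i)) (psnd (psnd i))) \<and>
    length \<sigma> = pfst i + d + 1"
proof -
  define r where "r = prod_encode (i, LEAST L. R B i L)"
  have "R B i (LEAST L. R B i L)" using assms(2) by (rule LeastI)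
  moreover have "\<not> R B i L" if "L < (LEAST L. R B i L)" for L using that by (rule not_less_Least)
  ultimately have ev: "event B r"
    unfolding event_def r_def prod_encode_inverse fst_conv snd_conv by blast
  have "total_weight B (Suc r) \<le> 1"
  proof -
    let ?E = "{j. j < Suc r \<and> event B j}"
    \<comment> \<open>A request has only one event, because the stage of an event is least; the
      weight of a request is thus counted once.\<close>
    have "inj_on pfst ?E"
    proof (rule inj_onI)
      fix a b assume ab: "a \<in> ?E" "b \<in> ?E" "pfst a = pfst b"
      then have "\<not> psnd a < psnd b" "\<not> psnd b < psnd a" unfolding event_def by auto
      then have "prod_decode a = prod_decode b" using ab(3) by (simp add: prod_eq_iff)
      then show "a = b" by (simp add: inj_eq[OF inj_prod_decode])
    qed
    have "total_weight B (Suc r) = (\<Sum>j\<in>?E. (1/2) ^ (event_len j + d))"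
    proof -
      have "(\<Sum>j\<in>?E. (1/2::real) ^ (event_len j + d)) =
          (\<Sum>j\<in>?E. of_bool (event B j) * (1/2) ^ (event_len j + d))"
        by (intro sum.cong) auto
      also have "\<dots> = total_weight B (Suc r)"
        unfolding total_weight_def by (intro sum.mono_neutral_left) auto
      finally show ?thesis by simp
    qed
    also have "\<dots> = (1/2) ^ d * (\<Sum>j\<in>?E. (1/2) ^ pfst (pfst j))"
      by (simp add: power_add sum_distrib_left mult.commute)
    also have "\<dots> \<le> (1/2) ^ d * 2 ^ d"
    proof (rule mult_left_mono)
      have "(\<Sum>j\<in>?E. (1/2::real) ^ pfst (pfst j)) = (\<Sum>i\<in>pfst ` ?E. (1/2) ^ pfst i)"
        using \<open>inj_on pfst ?E\<close> by (simp add: sum.reindex)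
      also have "\<dots> \<le> 2 ^ d"
        by (intro weight) (auto simp: event_def)
      finally show "(\<Sum>j\<in>?E. (1/2::real) ^ pfst (pfst j)) \<le> 2 ^ d" .
    qed simp
    also have "\<dots> = 1" by (simp add: power_one_over)
    finally show ?thesis .
  qed
  then have "total_weight B (Suc r) * 2 ^ (event_len r + d + 1) \<le> 1 * 2 ^ (event_len r + d + 1)"
    by (intro mult_right_mono) auto
  then have "real (event_code B r) + 1 \<le> 2 ^ (event_len r + d + 1)"
    using event_interval(2)[OF ev] by linarith
  then have "real (event_code B r) < real (2 ^ (event_len r + d + 1))" by simp
  then have "event_code B r < 2 ^ (event_len r + d + 1)" by (simp only: of_nat_less_iff)
  define \<sigma> where "\<sigma> = bits (event_code B r) (event_len r + d + 1)"
  have codes: "codes B (str_code \<sigma>) r"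
    using ev \<open>event_code B r < _\<close> by (simp add: codes_def \<sigma>_def)
  moreover have "(LEAST q. codes B (str_code \<sigma>) q) = r"
    using codes_prefix_eq[OF LeastI[of "codes B (str_code \<sigma>)", OF codes] codes] by simp
  ultimately have "request_machine B \<sigma> = Some (bits (pfst (psnd i)) (psnd (psnd i)))"
    unfolding request_machine_def by (auto simp: r_def Let_def)
  moreover have "length \<sigma> = pfst i + d + 1" by (simp add: \<sigma>_def r_def)
  ultimately show ?thesis by blast
qed

end

section \<open>From randomness to complexity\<close>

definition bits_value :: "bool list \<Rightarrow> nat" where
  "bits_value \<tau> = (SOME v. v < 2 ^ length \<tau> \<and> bits v (length \<tau>) = \<tau>)"

lemma bits_value: "bits_value \<tau> < 2 ^ length \<tau>" "bits (bits_value \<tau>) (length \<tau>) = \<tau>"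
  using someI_ex[OF bits_surj[of \<tau>]] by (simp_all add: bits_value_def)

lemma bits_value_bits: "v < 2 ^ m \<Longrightarrow> bits_value (bits v m) = v"
  using bits_value[of "bits v m"] by (auto dest: bits_inj)

section \<open>The Martin-Loef test of the requests\<close>

definition request_index :: "bool list \<Rightarrow> bool list \<Rightarrow> nat" where
  "request_index \<pi> \<tau> = prod_encode (length \<pi>, prod_encode (bits_value \<tau>, length \<tau>))"

definition requests :: "machine \<Rightarrow> cantor \<Rightarrow> nat set" where
  "requests U A = {request_index \<pi> \<tau> | \<pi> \<tau>. U A \<pi> = Some \<tau>}"

definition request_test :: "machine \<Rightarrow> cantor \<Rightarrow> nat \<Rightarrow> cantor set" where
  "request_test U A n = {X. \<exists>k>n. \<exists>i\<in>requests U A. \<forall>q\<in>block k i. \<not> X q}"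

text \<open>The numbers \<open>p\<close>, \<open>u\<close> and \<open>z\<close> code strings as pairs of value and length.\<close>

definition request_witness ::
  "(cantor \<Rightarrow> nat \<Rightarrow> nat) \<Rightarrow> cantor \<Rightarrow> nat \<Rightarrow> nat \<Rightarrow> nat \<Rightarrow> nat \<Rightarrow> nat \<Rightarrow> nat \<Rightarrow> bool" where
  "request_witness g A x k s p u z \<longleftrightarrow>
    pfst x < k \<and> psnd x = str_code (bits (pfst z) (psnd z)) \<and>
    g A (prod_encode (str_code (bits (pfst p) (psnd p)), s)) = Suc (str_code (bits (pfst u) (psnd u))) \<and>
    pfst u < 2 ^ psnd u \<and>
    (\<forall>j<psnd p + k + 1.
      prod_encode (prod_encode (prod_encode (psnd p, u), k), j) < psnd z \<and>
      even (pfst z div 2 ^ (psnd z - Suc (prod_encode (prod_encode (prod_encode (psnd p, u), k), j)))))"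

lemma request_witness_iff:
  assumes run: "\<And>\<sigma>. run A e (str_code \<sigma>) = map_option str_code (U A \<sigma>)"
    and g: "approximates g e"
  shows "(\<exists>\<sigma>. (\<exists>k s p u z. request_witness g A (prod_encode (n, str_code \<sigma>)) k s p u z) \<and>
    initial_segment \<sigma> X) \<longleftrightarrow> X \<in> request_test U A n"
proof
  assume "\<exists>\<sigma>. (\<exists>k s p u z. request_witness g A (prod_encode (n, str_code \<sigma>)) k s p u z) \<and> initial_segment \<sigma> X"
  then obtain \<sigma> k s p u z where w: "request_witness g A (prod_encode (n, str_code \<sigma>)) k s p u z"
    and \<sigma>: "initial_segment \<sigma> X" by blast
  let ?\<pi> = "bits (pfst p) (psnd p)" and ?\<tau> = "bits (pfst u) (psnd u)"
  have "n < k" and \<sigma>_eq: "\<sigma> = bits (pfst z) (psnd z)" and u: "pfst u < 2 ^ psnd u"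
    and halt: "g A (prod_encode (str_code ?\<pi>, s)) = Suc (str_code ?\<tau>)"
    using w by (auto simp: request_witness_def str_code_inj)
  have "run A e (str_code ?\<pi>) = Some (str_code ?\<tau>)"
    using halt approximatesD(3)[OF g] by blast
  then have "U A ?\<pi> = Some ?\<tau>"
    unfolding run by (auto simp: str_code_inj)
  \<comment> \<open>The bound on \<open>pfst u\<close> in the witness makes it the canonical value
    of the output string, so the guessed index is the true one.\<close>
  moreover have i: "request_index ?\<pi> ?\<tau> = prod_encode (psnd p, u)"
    using bits_value_bits[OF u] by (simp add: request_index_def)
  ultimately have "prod_encode (psnd p, u) \<in> requests U A"
    unfolding requests_def by force
  moreover have "\<forall>q\<in>block k (prod_encode (psnd p, u)). \<not> X q"
    unfolding ball_block
  proof (intro allI impI)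
    fix j assume j: "j < pfst (prod_encode (psnd p, u)) + k + 1"
    let ?q = "prod_encode (prod_encode (prod_encode (psnd p, u), k), j)"
    have q: "?q < psnd z" "even (pfst z div 2 ^ (psnd z - Suc ?q))"
      using w j unfolding request_witness_def by simp_all
    have "X ?q = \<sigma> ! ?q" using \<sigma> q(1) unfolding initial_segment_iff \<sigma>_eq by simp
    then show "\<not> X ?q" using q unfolding \<sigma>_eq by (simp add: nth_bits)
  qed
  ultimately show "X \<in> request_test U A n"
    using \<open>n < k\<close> unfolding request_test_def by blast
next
  assume "X \<in> request_test U A n"
  then obtain k \<pi> \<tau> where "n < k" and U: "U A \<pi> = Some \<tau>"
    and X: "\<forall>q\<in>block k (request_index \<pi> \<tau>). \<not> X q"
    unfolding request_test_def requests_def by blast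
  have "run A e (str_code \<pi>) = Some (str_code \<tau>)" unfolding run U by simp
  then obtain s where s: "g A (prod_encode (str_code \<pi>, s)) = Suc (str_code \<tau>)"
    using approximatesD(3)[OF g] by blast
  \<comment> \<open>An initial segment reaching past the last coordinate of the block shows that the
    whole block vanishes.\<close>
  define m where "m = Suc (Max (block k (request_index \<pi> \<tau>)))"
  have m: "q < m" if "q \<in> block k (request_index \<pi> \<tau>)" for q
    using Max_ge[OF finite_block that] by (simp add: m_def)
  obtain v where v: "bits v m = map X [0..<m]" using bits_surj[of "map X [0..<m]"] by auto
  have even: "even (v div 2 ^ (m - Suc q))" if "q \<in> block k (request_index \<pi> \<tau>)" for q
    using X that nth_bits[OF m[OF that], of v] m[OF that] by (simp add: v)
  have "\<forall>q\<in>block k (request_index \<pi> \<tau>). q < m \<and> even (v div 2 ^ (m - Suc q))"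
    using m even by blast
  then have "request_witness g A (prod_encode (n, str_code (map X [0..<m]))) k s
      (prod_encode (bits_value \<pi>, length \<pi>)) (prod_encode (bits_value \<tau>, length \<tau>)) (prod_encode (v, m))"
    unfolding ball_block request_index_def request_witness_def
    using \<open>n < k\<close> s by (simp add: bits_value v)
  moreover have "initial_segment (map X [0..<m]) X" by (simp add: initial_segment_def)
  ultimately show "\<exists>\<sigma>. (\<exists>k s p u z. request_witness g A (prod_encode (n, str_code \<sigma>)) k s p u z) \<and> initial_segment \<sigma> X"
    by blast
qed

lemma uniformly_Sigma1_request_test:
  assumes "computable_machine U"
  shows "uniformly_Sigma1 A (request_test U A)"
proof -
  obtain e where run: "\<And>A \<sigma>. run A e (str_code \<sigma>) = map_option str_code (U A \<sigma>)"
    using assms unfolding computable_machine_def by blast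
  obtain g where g: "approximates g e" using approximation_exists by blast
  let ?P = "\<lambda>A x w. request_witness g A x (pfst (pfst w)) (psnd (pfst w)) (pfst (psnd w))
    (pfst (psnd (psnd w))) (psnd (psnd (psnd w)))"
  have "decidable (\<lambda>A z. ?P A (pfst z) (psnd z))"
    unfolding request_witness_def by (intro comp_intros computable_comp[OF approximatesD(1)[OF g]])
  then obtain e' where e': "\<And>A x. run A e' x \<noteq> None \<longleftrightarrow> (\<exists>w. ?P A x w)"
    using computable_mu[of ?P] by blast
  have P: "(\<exists>w. ?P A x w) \<longleftrightarrow> (\<exists>k s p u z. request_witness g A x k s p u z)" for A x
  proof
    assume "\<exists>k s p u z. request_witness g A x k s p u z"
    then obtain k s p u z where "request_witness g A x k s p u z" by blast
    then have "?P A x (prod_encode (prod_encode (k, s), prod_encode (p, prod_encode (u, z))))" by simp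
    then show "\<exists>w. ?P A x w" by blast
  qed blast
  show ?thesis
    unfolding uniformly_Sigma1_def
  proof (intro exI[of _ e'] allI set_eqI)
    fix n X
    show "X \<in> request_test U A n \<longleftrightarrow>
      X \<in> {X. \<exists>\<sigma>. run A e' (prod_encode (n, str_code \<sigma>)) \<noteq> None \<and> initial_segment \<sigma> X}"
      unfolding mem_Collect_eq e' P by (rule request_witness_iff[OF run g, symmetric])
  qed
qed

lemma sum_half_powers_le:
  assumes "finite J" "\<And>j. j \<in> J \<Longrightarrow> n \<le> j"
  shows "(\<Sum>j\<in>J. (1/2) ^ (j + 1)) \<le> (1/2::real) ^ n"
proof -
  have "(\<Sum>j\<in>J. (1/2::real) ^ (j + 1)) = (1/2) ^ (n + 1) * (\<Sum>j\<in>J. (1/2) ^ (j - n))"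
    using assms(2) by (simp add: sum_distrib_left flip: power_add)
  also have "(\<Sum>j\<in>J. (1/2::real) ^ (j - n)) = (\<Sum>i\<in>(\<lambda>j. j - n) ` J. (1/2) ^ i)"
    using assms(2) by (subst sum.reindex) (auto intro!: inj_onI dest: eq_diff_iff)
  also have "(1/2) ^ (n + 1) * \<dots> \<le> (1/2) ^ (n + 1) * (\<Sum>i. (1/2::real) ^ i)"
    using assms(1) by (intro mult_left_mono sum_le_suminf summable_geometric) auto
  also have "\<dots> = (1/2) ^ n" by (subst suminf_geometric) auto
  finally show ?thesis .
qed

text \<open>The union is indexed by \<open>k\<close> and the programs \<pi> in the domain, so that
  Kraft's inequality applies. Enlarging a finite index set to a rectangle splits the sum into a
  geometric sum over \<open>k\<close> and a Kraft sum over \<pi>.\<close>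

lemma measure_request_test:
  assumes "prefix_free (dom (U A))"
  shows "measure coin_measure (request_test U A n) \<le> (1/2) ^ n"
proof -
  let ?I = "{n<..} \<times> dom (U A)"
  define V where "V p = {X. \<forall>q\<in>block (fst p) (request_index (snd p) (the (U A (snd p)))). \<not> X q}"
    for p :: "nat \<times> bool list"
  have eq: "request_test U A n = (\<Union>p\<in>?I. V p)"
    unfolding request_test_def requests_def V_def by force
  have "measure coin_measure (\<Union>p\<in>?I. V p) \<le> (1/2) ^ n"
  proof (rule measure_countable_Union_le)
    show "V p \<in> sets coin_measure" for p by (simp add: V_def)
    show "(\<Sum>p\<in>F. measure coin_measure (V p)) \<le> (1/2) ^ n" if F: "finite F" "F \<subseteq> ?I" for F
    proof -
      have "(\<Sum>p\<in>F. measure coin_measure (V p)) = (\<Sum>p\<in>F. (1/2) ^ (fst p + 1) * (1/2) ^ length (snd p))"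
        unfolding V_def measure_block
        by (simp add: request_index_def power_add mult_ac)
      also have "\<dots> \<le> (\<Sum>p\<in>fst ` F \<times> snd ` F. (1/2) ^ (fst p + 1) * (1/2) ^ length (snd p))"
        using F(1) by (intro sum_mono2) (auto intro: rev_image_eqI)
      also have "\<dots> = (\<Sum>j\<in>fst ` F. (1/2) ^ (j + 1)) * (\<Sum>\<pi>\<in>snd ` F. (1/2) ^ length \<pi>)"
        unfolding sum_product sum.cartesian_product by (simp add: case_prod_beta)
      also have "\<dots> \<le> (1/2) ^ n * 1"
        using F by (intro mult_mono sum_half_powers_le kraft[OF assms] sum_nonneg) auto
      finally show ?thesis by simp
    qed
  qed
  then show ?thesis unfolding eq .
qed

lemma martin_loef_request_test:
  assumes "prefix_free_machine U"
  shows "martin_loef_test A (request_test U A)"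
  unfolding martin_loef_test_def
proof (intro conjI allI)
  show "uniformly_Sigma1 A (request_test U A)"
    using assms unfolding prefix_free_machine_def by (intro uniformly_Sigma1_request_test) blast
  show "request_test U A (Suc n) \<subseteq> request_test U A n" for n
    unfolding request_test_def by (auto dest: Suc_lessD)
  show "measure coin_measure (request_test U A n) \<le> (1/2) ^ n" for n
    using assms unfolding prefix_free_machine_def by (intro measure_request_test) blast
qed

text \<open>Failure of the claim supplies, for every \<open>k\<close> and every condition
  \<open>S\<close>, a block as required by \<open>random_meeting_blocks\<close>. The resulting
  \<open>B\<close>-random set lies in all levels of the test relative to \<open>A\<close>.\<close>

lemma leq_LR_covering:
  assumes "prefix_free_machine U" "leq_LR A B"
  shows "\<exists>k S. Sigma1_class B S \<and> measure coin_measure S < 1 \<and>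
    (\<forall>i\<in>requests U A. measure coin_measure ({X. \<forall>q\<in>block k i. \<not> X q} - S) = 0)"
proof (rule ccontr)
  assume no: "\<not> ?thesis"
  have "\<exists>X. martin_loef_random B X \<and> (\<forall>k. \<exists>D\<in>block k ` requests U A. \<forall>j\<in>D. \<not> X j)"
  proof (rule random_meeting_blocks)
    fix k S assume S: "Sigma1_class B S" "measure coin_measure S < 1"
    obtain i where "i \<in> requests U A" "measure coin_measure ({X. \<forall>q\<in>block k i. \<not> X q} - S) \<noteq> 0"
      using no S by blast
    then show "\<exists>D\<in>block k ` requests U A. 0 < measure coin_measure ({X. \<forall>j\<in>D. \<not> X j} - S)"
      unfolding zero_less_measure_iff by (intro bexI[of _ "block k i"] imageI)
  qed auto
  then obtain X where X: "martin_loef_random B X"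
    and meet: "\<And>k. \<exists>i\<in>requests U A. \<forall>j\<in>block k i. \<not> X j"
    by blast
  have "X \<in> request_test U A n" for n
    using meet[of "Suc n"] unfolding request_test_def by blast
  moreover have "martin_loef_random A X"
    using assms(2) X unfolding leq_LR_def by blast
  ultimately show False
    using martin_loef_request_test[OF assms(1)] unfolding martin_loef_random_def by blast
qed

theorem theorem2p6:
  fixes U :: machine and A B :: cantor
  assumes "universal_machine U"
    and "leq_LR A B"
  shows "leq_LK U A B"
proof -
  have pf: "prefix_free_machine U" using assms(1) by (simp add: universal_machine_def)
  obtain k S where "Sigma1_class B S" and S: "measure coin_measure S < 1"
    and null: "\<And>i. i \<in> requests U A \<Longrightarrow> measure coin_measure ({X. \<forall>q\<in>block k i. \<not> X q} - S) = 0"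
    using leq_LR_covering[OF pf assms(2)] by blast
  then obtain e where e: "S = {X. \<exists>\<sigma>. run B e (str_code \<sigma>) \<noteq> None \<and> initial_segment \<sigma> X}"
    unfolding Sigma1_class_def by blast
  obtain g where g: "approximates g e" using approximation_exists by blast
  interpret approximated_class B S e g by unfold_locales (fact e, fact g)
  obtain c d where weight: "\<And>F. finite F \<Longrightarrow> F \<subseteq> {i. \<exists>L. nearly_covered g k c B i L} \<Longrightarrow>
      (\<Sum>i\<in>F. (1/2) ^ pfst i) \<le> (2::real) ^ d"
    using nearly_covered_weight[OF S, of k] by blast
  let ?M = "request_machine (nearly_covered g k c) d"
  have R: "decidable (\<lambda>A z. nearly_covered g k c A (pfst z) (psnd z))"
    using approximatesD(1)[OF g] by (rule decidable_nearly_covered)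
  \<comment> \<open>The parameters \<open>g\<close>, \<open>k\<close>, \<open>c\<close> and
    \<open>d\<close> are built into the machine, which is prefix-free for all oracles; the weight
    bound enters only for \<open>B\<close>.\<close>
  obtain \<rho> where \<rho>: "\<And>A \<sigma>. U A (\<rho> @ \<sigma>) = ?M A \<sigma>"
    using assms(1) prefix_free_request_machine[OF R] unfolding universal_machine_def by blast
  define c' where "c' = length \<rho> + d + 1"
  have le: "K U B \<tau> \<le> enat (length \<pi>) + enat c'" if \<pi>: "U A \<pi> = Some \<tau>" for \<pi> \<tau>
  proof -
    let ?i = "request_index \<pi> \<tau>"
    have "?i \<in> requests U A" using \<pi> unfolding requests_def by blast
    then obtain L where "nearly_covered g k c B ?i L"
      using nearly_covered_of_null[OF null] by blast
    then obtain \<sigma> where "?M B \<sigma> = Some (bits (pfst (psnd ?i)) (psnd (psnd ?i)))"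
      and len: "length \<sigma> = pfst ?i + d + 1"
      using request_machine_output[OF R weight] by blast
    then have "U B (\<rho> @ \<sigma>) = Some \<tau>" by (simp add: \<rho> request_index_def bits_value)
    then have "K U B \<tau> \<le> enat (length (\<rho> @ \<sigma>))" unfolding K_def by (intro INF_lower) simp
    also have "\<dots> = enat (length \<pi>) + enat c'" by (simp add: len request_index_def c'_def)
    finally show ?thesis .
  qed
  have "K U B \<tau> \<le> K U A \<tau> + enat c'" for \<tau>
  proof (cases "\<exists>\<pi>. U A \<pi> = Some \<tau>")
    case True
    \<comment> \<open>A shortest program attains the infimum in \<open>K\<close>.\<close>
    then obtain \<pi> where \<pi>: "U A \<pi> = Some \<tau>" and "\<And>\<sigma>. U A \<sigma> = Some \<tau> \<Longrightarrow> length \<pi> \<le> length \<sigma>"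
      using ex_has_least_nat[of "\<lambda>\<sigma>. U A \<sigma> = Some \<tau>" _ length] by blast
    then have "enat (length \<pi>) \<le> K U A \<tau>" unfolding K_def by (intro INF_greatest) simp
    then have "enat (length \<pi>) + enat c' \<le> K U A \<tau> + enat c'" by (rule add_right_mono)
    then show ?thesis using le[OF \<pi>] by (rule order_trans[rotated])
  next
    case False
    then have "K U A \<tau> = \<infinity>" by (simp add: K_def top_enat_def)
    then show ?thesis by simp
  qed
  then show ?thesis unfolding leq_LK_def by blast
qed

end
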